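(* (1) For any complex Banach space $X$ of (complex) dimension at least $2$, there is an equivalent (complex) norm on $X$ for which $X$ has only trivial real isometries. (2) For any complex Banach space $X$ with canonical linear structure, with associated conjugation map $c$, there is an equivalent (complex) norm on $X$ for which $X$ has only trivial and conjugation real isometries, i.e. for which the group of real isometries of $X$ is exactly $\{\lambda\mathrm{Id}:|\lambda|=1\}\cup\{\lambda c:|\lambda|=1\}$.
   Context: A real isometry on a complex Banach space $X$ is a surjective $\mathbb{R}$-linear isometry of $X$ onto itself. It is trivial if it is of the form $\lambda\mathrm{Id}$ with $\lambda\in\mathbb{C}$, $|\lambda|=1$. The complex linear structure on $X$ is canonical if $X$ is equal to a real cartesian sum $Z\oplus Z$ such that multiplication by $i$ on $X$ is $i(y,z)=(-z,y)$ for $y,z\in Z$ (so $X$ is canonically isomorphic to the complexification of $Z$), and the conjugation map $c$ defined by $c(y,z)=(y,-z)$ is an isometry on $X$. A conjugation isometry is then a real isometry of the form $\lambda c$, with $\lambda\in\mathbb{C}$, $|\lambda|=1$. *)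

theory Defs
  imports "HOL-Analysis.Analysis"
begin

class complex_normed_vector = real_normed_vector +
  fixes scaleC :: "complex \<Rightarrow> 'a \<Rightarrow> 'a" (infixr "*\<^sub>C" 75)
  assumes scaleC_add_right: "a *\<^sub>C (x + y) = a *\<^sub>C x + a *\<^sub>C y"
    and scaleC_add_left: "(a + b) *\<^sub>C x = a *\<^sub>C x + b *\<^sub>C x"
    and scaleC_scaleC: "a *\<^sub>C b *\<^sub>C x = (a * b) *\<^sub>C x"
    and scaleC_one: "1 *\<^sub>C x = x"
    and scaleC_of_real: "complex_of_real r *\<^sub>C x = r *\<^sub>R x"
    and norm_scaleC: "norm (a *\<^sub>C x) = cmod a * norm x"

class complex_banach = complex_normed_vector + banach

global_interpretation complex_vector:
  vector_space "scaleC :: complex \<Rightarrow> 'a \<Rightarrow> 'a::complex_normed_vector"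
  by unfold_locales
    (simp_all add: scaleC_add_right scaleC_add_left scaleC_scaleC scaleC_one)

instantiation complex :: complex_banach
begin

definition scaleC_complex :: "complex \<Rightarrow> complex \<Rightarrow> complex"
  where "scaleC_complex a x = a * x"

instance
  by standard (simp_all add: scaleC_complex_def algebra_simps norm_mult scaleR_conv_of_real)

end

text \<open>
  The library dimension of a vector space without a finite basis is \<open>0\<close>, so a lower bound
  on the dimension is stated through the cardinality of a basis.
\<close>

definition complex_dim_at_least :: "nat \<Rightarrow> 'a::complex_normed_vector itself \<Rightarrow> bool"
  where "complex_dim_at_least n _ \<longleftrightarrow>
    (\<exists>B :: 'a set. complex_vector.independent B \<and> complex_vector.span B = UNIV \<and>
      (infinite B \<or> n \<le> card B))"

definition is_complex_norm :: "('a::complex_normed_vector \<Rightarrow> real) \<Rightarrow> bool"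
  where "is_complex_norm N \<longleftrightarrow>
    (\<forall>x. 0 \<le> N x) \<and> (\<forall>x. N x = 0 \<longleftrightarrow> x = 0) \<and>
    (\<forall>x y. N (x + y) \<le> N x + N y) \<and> (\<forall>a x. N (a *\<^sub>C x) = cmod a * N x)"

definition equivalent_complex_norm :: "('a::complex_normed_vector \<Rightarrow> real) \<Rightarrow> bool"
  where "equivalent_complex_norm N \<longleftrightarrow> is_complex_norm N \<and>
    (\<exists>m>0. \<exists>M>0. \<forall>x. m * norm x \<le> N x \<and> N x \<le> M * norm x)"

text \<open>Isometries are taken with respect to a norm \<open>N\<close>, not necessarily the one of the type class.\<close>

definition real_isometry :: "('a::complex_normed_vector \<Rightarrow> real) \<Rightarrow> ('a \<Rightarrow> 'a) \<Rightarrow> bool"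
  where "real_isometry N T \<longleftrightarrow> linear T \<and> surj T \<and> (\<forall>x y. N (T x - T y) = N (x - y))"

definition trivial_isometry :: "('a::complex_normed_vector \<Rightarrow> 'a) \<Rightarrow> bool"
  where "trivial_isometry T \<longleftrightarrow> (\<exists>u. cmod u = 1 \<and> T = (\<lambda>x. u *\<^sub>C x))"

text \<open>
  A canonical complex structure on \<open>X\<close> is given by an identification \<open>J\<close> of the cartesian sum
  \<open>Z \<oplus> Z\<close> of a real Banach space \<open>Z\<close> with \<open>X\<close>. The library norm on \<open>Z \<times> Z\<close> only serves to give
  the product topology: \<open>J\<close> is a real-linear homeomorphism (its inverse is bounded by the open
  mapping theorem), not an isometry.
\<close>

definition conjugation :: "('z::banach \<times> 'z \<Rightarrow> 'a) \<Rightarrow> 'a \<Rightarrow> 'a::complex_banach"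
  where "conjugation J x = (case inv J x of (y, z) \<Rightarrow> J (y, - z))"

definition canonical_complex_structure :: "('z::banach \<times> 'z \<Rightarrow> 'a::complex_banach) \<Rightarrow> bool"
  where "canonical_complex_structure J \<longleftrightarrow>
    bounded_linear J \<and> bij J \<and>
    (\<forall>y z. \<i> *\<^sub>C J (y, z) = J (- z, y)) \<and>
    real_isometry norm (conjugation J)"

definition conjugation_isometry :: "('z::banach \<times> 'z \<Rightarrow> 'a::complex_banach) \<Rightarrow> ('a \<Rightarrow> 'a) \<Rightarrow> bool"
  where "conjugation_isometry J T \<longleftrightarrow>
    (\<exists>u. cmod u = 1 \<and> T = (\<lambda>x. u *\<^sub>C conjugation J x))"

end

theory Submission
  imports Defs
begin

text \<open>
  The new norm \<open>N\<close> is the supremum of a small multiple of (essentially) the old norm and of the moduli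
  of a family of complex functionals. The family is arranged so that each member \<open>h\<close> is exposed: there
  is a vector at which \<open>\<bar>h\<bar>\<close> beats every other member by a fixed margin, so that \<open>N = \<bar>h\<bar>\<close> near that
  vector. Conversely, if \<open>N\<close> agrees on some ball with the modulus of a real linear map, this map has
  the modulus of a member of the family (\<open>N_local_modulus\<close>). This property is expressed through \<open>N\<close>
  alone, so a real isometry \<open>T\<close> permutes the family up to unimodular factors and complex conjugation.

  It remains to choose a family with no symmetry, on spaces of arbitrary density. It is built from a
  biorthogonal system \<open>(e\<^sub>i, f\<^sub>i)\<close> with \<open>i\<close> in a well-ordered index set and from functionals \<open>g\<^sub>i\<close>,
  such that the \<open>f\<^sub>i\<close> and \<open>g\<^sub>i\<close> together separate points. Its members are the \<open>f\<^sub>i\<close> and, for \<open>j < k\<close>,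
  small multiples of \<open>g\<^sub>k\<close> added to \<open>f\<^sub>j + 2 f\<^sub>k\<close> and to \<open>f\<^sub>j + \<zeta> f\<^sub>k\<close>, suitably normalized. Exposure of
  the \<open>f\<^sub>i\<close> is stronger than that of the two-index members, so \<open>T\<close> permutes the \<open>f\<^sub>i\<close> among themselves;
  the unequal coefficients encode the order, so that this permutation is an automorphism of a
  well-order, hence the identity. The two-index members then force all the unimodular factors to be
  equal, also on the \<open>g\<^sub>i\<close> (\<open>isometry_acts_by_phase\<close>), and \<open>T\<close> is a scalar because the \<open>f\<^sub>i\<close> and \<open>g\<^sub>i\<close>
  separate points. Conjugation is excluded by taking \<open>\<zeta> = 3\<i>\<close>; with \<open>\<zeta> = -3\<close> and functionals that
  commute with the given conjugation, it survives as an isometry, which is what the second statement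
  asks for.

  The biorthogonal system is found by Zorn's lemma. Let \<open>(e\<^sub>i, f\<^sub>i)\<close> be maximal among the biorthogonal
  systems of norm-one vectors with functionals of norm at most three. A vector annihilated by all \<open>f\<^sub>i\<close>
  and by functionals norming the span of the \<open>e\<^sub>i\<close> stays away from this span, so Hahn--Banach would
  extend the system by it; hence these functionals are total, and for an infinite system there are no
  more of them than indices (\<open>exists_biorthogonal_system\<close>).
\<close>

section \<open>Complex functionals\<close>

definition cfunctional :: "real \<Rightarrow> ('a::complex_normed_vector \<Rightarrow> complex) \<Rightarrow> bool"
  where "cfunctional K f \<longleftrightarrow> (\<forall>x y. f (x + y) = f x + f y) \<and> (\<forall>c x. f (c *\<^sub>C x) = c * f x) \<and>
    (\<forall>x. cmod (f x) \<le> K * norm x)"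

lemma cfunctional_add: "cfunctional K f \<Longrightarrow> f (x + y) = f x + f y"
  and cfunctional_scaleC: "cfunctional K f \<Longrightarrow> f (c *\<^sub>C x) = c * f x"
  and cfunctional_bound: "cfunctional K f \<Longrightarrow> cmod (f x) \<le> K * norm x"
  unfolding cfunctional_def by blast+

lemma cfunctional_scaleR: "cfunctional K f \<Longrightarrow> f (r *\<^sub>R x) = of_real r * f x"
  using cfunctional_scaleC[of K f "of_real r" x] by (simp add: scaleC_of_real)

lemma cfunctional_linear: "cfunctional K f \<Longrightarrow> linear f"
  by (intro linearI) (auto simp: cfunctional_add cfunctional_scaleR scaleR_conv_of_real)

lemma cfunctional_diff: "cfunctional K f \<Longrightarrow> f (x - y) = f x - f y"
  by (rule linear_diff[OF cfunctional_linear])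

lemma cfunctional_0: "cfunctional K f \<Longrightarrow> f 0 = 0"
  by (rule linear_0[OF cfunctional_linear])

lemma cfunctional_mono: "cfunctional K f \<Longrightarrow> K \<le> K' \<Longrightarrow> cfunctional K' f"
  unfolding cfunctional_def by (meson mult_right_mono norm_ge_zero order_trans)

lemma cfunctional_zero: "0 \<le> K \<Longrightarrow> cfunctional K (\<lambda>_. 0)"
  by (simp add: cfunctional_def)

text \<open>
  Both maps have the same kernel, so \<open>A\<close> factors through \<open>k\<close>, and the factor is a real linear isometry
  of the complex plane: a rotation, possibly after a reflection.
\<close>

lemma modulus_eq_imp_unimodular_multiple:
  assumes A: "linear A" and k: "cfunctional K k" and eq: "\<And>x. cmod (A x) = cmod (k x)"
  shows "\<exists>u c. cmod u = 1 \<and> (c = (\<lambda>z. z) \<or> c = cnj) \<and> (\<forall>x. A x = u * c (k x))"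
proof (cases "\<forall>x. k x = 0")
  case True
  then have "\<forall>x. A x = 1 * k x" using eq by simp
  then show ?thesis by (intro exI[of _ 1] exI[of _ "\<lambda>z. z"]) auto
next
  case False
  then obtain x0 where x0: "k x0 \<noteq> 0" by blast
  define v where "v = inverse (k x0) *\<^sub>C x0"
  have kv: "k v = 1" using x0 by (simp add: v_def cfunctional_scaleC[OF k])
  define p q where "p = A v" and "q = A (\<i> *\<^sub>C v)"
  have Aform: "A x = of_real (Re (k x)) * p + of_real (Im (k x)) * q" for x
  proof -
    have sp: "k x *\<^sub>C v = Re (k x) *\<^sub>R v + Im (k x) *\<^sub>R (\<i> *\<^sub>C v)"
      by (metis (no_types) complex_eq mult.commute scaleC_add_left scaleC_of_real scaleC_scaleC)
    have "k (x - k x *\<^sub>C v) = 0"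
      by (simp add: cfunctional_diff[OF k] cfunctional_scaleC[OF k] kv)
    then have "A (x - k x *\<^sub>C v) = 0" using eq by (metis norm_eq_zero)
    then have "A x = A (k x *\<^sub>C v)" by (simp add: linear_diff[OF A])
    also have "\<dots> = of_real (Re (k x)) * p + of_real (Im (k x)) * q"
      unfolding sp p_def q_def
      by (simp add: linear_add[OF A] linear_scale[OF A] scaleR_conv_of_real)
    finally show ?thesis .
  qed
  have p1: "cmod p = 1" using eq[of v] kv by (simp add: p_def)
  have q1: "cmod q = 1" using eq[of "\<i> *\<^sub>C v"] kv by (simp add: q_def cfunctional_scaleC[OF k])
  have "cmod (p + q) = cmod (1 + \<i>)"
    using eq[of "v + \<i> *\<^sub>C v"] kv
    by (simp add: p_def q_def linear_add[OF A] cfunctional_add[OF k] cfunctional_scaleC[OF k])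
  then have pq: "(cmod (p + q))\<^sup>2 = 2" by (simp add: cmod_power2)
  define r where "r = q / p"
  have p0: "p \<noteq> 0" using p1 by auto
  have r1: "cmod r = 1" using p1 q1 by (simp add: r_def norm_divide)
  have "p + q = p * (1 + r)" using p0 by (simp add: r_def field_simps)
  then have "(cmod (1 + r))\<^sup>2 = 2" using pq p1 by (simp add: norm_mult)
  then have "Re r = 0" using r1 cmod_power2[of r] cmod_power2[of "1 + r"] by (simp add: power2_eq_square algebra_simps)
  moreover have "(Im r)\<^sup>2 = 1" using r1 cmod_power2[of r] \<open>Re r = 0\<close> by simp
  ultimately have "r = \<i> \<or> r = - \<i>" by (auto simp: complex_eq_iff power2_eq_1_iff)
  moreover have qr: "q = p * r" using p0 by (simp add: r_def)
  ultimately consider "q = p * \<i>" | "q = - (p * \<i>)" by auto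
  then show ?thesis
  proof cases
    case 1
    have "A x = p * (k x)" for x unfolding Aform 1 by (simp add: complex_eq_iff algebra_simps)
    with p1 show ?thesis by (intro exI[of _ p] exI[of _ "\<lambda>z. z"]) auto
  next
    case 2
    have "A x = p * cnj (k x)" for x unfolding Aform 2 by (simp add: complex_eq_iff algebra_simps)
    with p1 show ?thesis by (intro exI[of _ p] exI[of _ cnj]) auto
  qed
qed

lemma strict_midpoint_complex:
  assumes "Im z \<noteq> 0" and "t \<noteq> 0"
  shows "2 * cmod z < cmod (z + of_real t) + cmod (z - of_real t)"
proof (rule ccontr)
  let ?u = "z + of_real t" and ?v = "z - of_real t"
  assume "\<not> ?thesis"
  moreover have "cmod (?u + ?v) = 2 * cmod z"
    by (simp add: mult_2[symmetric] norm_mult)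
  ultimately have "norm (?u + ?v) = norm ?u + norm ?v"
    using norm_triangle_ineq[of ?u ?v] by linarith
  then have eq: "norm ?u *\<^sub>R ?v = norm ?v *\<^sub>R ?u" using norm_triangle_eq by blast
  then have "Im (norm ?u *\<^sub>R ?v) = Im (norm ?v *\<^sub>R ?u)" by simp
  then have n: "norm ?u = norm ?v" using assms by simp
  have "norm ?u \<noteq> 0" using assms by (auto simp: complex_eq_iff)
  then have "?v = ?u" using eq n by simp
  then show False using assms by (simp add: complex_eq_iff)
qed

text \<open>
  Two complex parameters are four real ones, more than the real dimension of the target.
\<close>

lemma two_dim_kernel:
  fixes h :: "'a::complex_normed_vector \<Rightarrow> complex"
  assumes h: "linear h"
  shows "\<exists>s t. (s, t) \<noteq> (0, 0) \<and> h (s *\<^sub>C u + t *\<^sub>C v) = 0"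
proof (rule ccontr)
  assume none: "\<not> ?thesis"
  define G where "G = (\<lambda>st::complex \<times> complex. h (fst st *\<^sub>C u + snd st *\<^sub>C v))"
  have sc: "(r *\<^sub>R s) *\<^sub>C w = r *\<^sub>R (s *\<^sub>C w)" for r s and w :: 'a
    by (metis scaleC_of_real scaleC_scaleC scaleR_conv_of_real)
  have "linear G"
    unfolding G_def
    by (intro linearI)
      (simp_all add: scaleC_add_left linear_add[OF h] sc linear_scale[OF h] algebra_simps
        flip: scaleR_add_right)
  moreover have "inj G"
    using none \<open>linear G\<close> by (subst linear_injective_0) (auto simp: G_def zero_prod_def)
  ultimately have "dim (range G) = dim (UNIV :: (complex \<times> complex) set)"
    using dim_image_eq by (metis UNIV_I inj_on_subset span_UNIV subset_UNIV)
  then have "4 \<le> dim (UNIV :: complex set)"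
    using dim_subset[of "range G" UNIV] by simp
  then show False by simp
qed

lemma exists_aligning_phase: "\<exists>u. cmod u = 1 \<and> cmod (p + u * q) = cmod p + cmod q"
proof (cases "p = 0 \<or> q = 0")
  case True
  then show ?thesis by (intro exI[of _ 1]) auto
next
  case False
  define u where "u = sgn p / sgn q"
  have "u * q = of_real (cmod q) * sgn p"
    using False by (simp add: u_def sgn_eq field_simps)
  moreover have "p = of_real (cmod p) * sgn p" using False by (simp add: sgn_eq)
  ultimately have "p + u * q = of_real (cmod p + cmod q) * sgn p"
    by (simp add: algebra_simps)
  then have "cmod (p + u * q) = cmod p + cmod q"
    using False by (simp only: norm_mult norm_of_real norm_sgn) simp
  moreover have "cmod u = 1" using False by (simp add: u_def norm_divide norm_sgn)
  ultimately show ?thesis by blast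
qed

lemma cmod_parallelogram:
  fixes p q :: complex
  shows "(cmod (p + q))\<^sup>2 + (cmod (p - q))\<^sup>2 = 2 * (cmod p)\<^sup>2 + 2 * (cmod q)\<^sup>2"
  unfolding cmod_power2 by (simp add: power2_eq_square algebra_simps)

lemma real_isometry_inv:
  assumes T: "real_isometry N T" and N: "is_complex_norm N"
  shows "real_isometry N (inv T)" "T (inv T x) = x" "inv T (T x) = x"
proof -
  have lin: "linear T" and sur: "surj T" and iso: "N (T x - T y) = N (x - y)" for x y
    using T by (auto simp: real_isometry_def)
  have inj: "inj T"
  proof (rule injI)
    fix x y assume "T x = T y"
    then have "N (x - y) = N 0" using iso[of x y] by simp
    then have "x - y = 0" using N unfolding is_complex_norm_def by metis
    then show "x = y" by simp
  qed
  show 1: "T (inv T x) = x" for x using sur by (simp add: surj_f_inv_f)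
  show 2: "inv T (T x) = x" for x using inj by simp
  have "linear (inv T)"
    by (intro linearI) (metis 1 2 linear_add[OF lin], metis 1 2 linear_scale[OF lin])
  moreover have "surj (inv T)" using inj by (rule inj_imp_surj_inv)
  moreover have "N (inv T x - inv T y) = N (x - y)" for x y using iso[of "inv T x" "inv T y"] by (simp add: 1)
  ultimately show "real_isometry N (inv T)" by (simp add: real_isometry_def)
qed

lemma unimodular_multiple_unique:
  assumes "c = (\<lambda>z. z) \<or> c = cnj" "c' = (\<lambda>z. z) \<or> c' = cnj" and "\<alpha> \<noteq> 0"
    and eq: "\<And>x. \<alpha> * c x = \<beta> * c' x"
  shows "c = c'" "\<alpha> = \<beta>"
proof -
  show ab: "\<alpha> = \<beta>" using eq[of 1] assms(1,2) by auto
  then have "c \<i> = c' \<i>" using eq[of \<i>] \<open>\<alpha> \<noteq> 0\<close> by simp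
  then show "c = c'" using assms(1,2) by (auto simp: complex_eq_iff)
qed

section \<open>The Hahn--Banach theorem\<close>

definition sublinear :: "('a::real_vector \<Rightarrow> real) \<Rightarrow> bool"
  where "sublinear p \<longleftrightarrow> (\<forall>x y. p (x + y) \<le> p x + p y) \<and> (\<forall>t x. 0 \<le> t \<longrightarrow> p (t *\<^sub>R x) = t * p x)"

lemma sublinear_add: "sublinear p \<Longrightarrow> p (x + y) \<le> p x + p y"
  and sublinear_scaleR: "sublinear p \<Longrightarrow> 0 \<le> t \<Longrightarrow> p (t *\<^sub>R x) = t * p x"
  unfolding sublinear_def by blast+

lemma sublinear_0: "sublinear p \<Longrightarrow> p 0 = 0"
  using sublinear_scaleR[of p 0 0] by simp

lemma sublinear_neg: "sublinear p \<Longrightarrow> - p (- x) \<le> p x"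
  using sublinear_add[of p x "- x"] sublinear_0[of p] by simp

text \<open>
  The largest sublinear functional below \<open>p\<close> whose value at \<open>- v\<close> is at most \<open>- p v\<close>. A minimal
  sublinear functional equals all its flattenings, so that it is odd and hence linear; and minimizing
  below \<open>flatten p v\<close> instead of \<open>p\<close> keeps the value at \<open>v\<close>.
\<close>

definition flatten :: "('a::real_vector \<Rightarrow> real) \<Rightarrow> 'a \<Rightarrow> 'a \<Rightarrow> real"
  where "flatten p v x = (INF t\<in>{0..}. p (x + t *\<^sub>R v) - t * p v)"

lemma flatten:
  assumes p: "sublinear p"
  shows "sublinear (flatten p v)" "flatten p v x \<le> p x" "flatten p v (- v) \<le> - p v"
proof -
  have lower: "- p (- x) \<le> p (x + t *\<^sub>R v) - t * p v" if "0 \<le> t" for x t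
    using sublinear_add[OF p, of "x + t *\<^sub>R v" "- x"] sublinear_scaleR[OF p that, of v] by simp
  have bdd: "bdd_below ((\<lambda>t. p (x + t *\<^sub>R v) - t * p v) ` {0..})" for x
    using lower by (intro bdd_belowI2[of _ "- p (- x)"]) auto
  have le: "flatten p v x \<le> p (x + t *\<^sub>R v) - t * p v" if "0 \<le> t" for x t
    unfolding flatten_def using that by (intro cINF_lower bdd) auto
  have ge: "c \<le> flatten p v x" if "\<And>t. 0 \<le> t \<Longrightarrow> c \<le> p (x + t *\<^sub>R v) - t * p v" for c x
    unfolding flatten_def using that by (intro cINF_greatest) auto
  show "flatten p v x \<le> p x" using le[of 0 x] by simp
  show "flatten p v (- v) \<le> - p v" using le[of 1 "- v"] sublinear_0[OF p] by simp
  have add: "flatten p v (x + y) \<le> flatten p v x + flatten p v y" for x y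
  proof -
    have "flatten p v (x + y) - (p (x + t *\<^sub>R v) - t * p v) \<le> flatten p v y" if t: "0 \<le> t" for t
    proof (rule ge)
      fix s :: real assume s: "0 \<le> s"
      have "flatten p v (x + y) \<le> p ((x + t *\<^sub>R v) + (y + s *\<^sub>R v)) - (t + s) * p v"
        using le[of "t + s" "x + y"] s t by (simp add: algebra_simps)
      then show "flatten p v (x + y) - (p (x + t *\<^sub>R v) - t * p v) \<le> p (y + s *\<^sub>R v) - s * p v"
        using sublinear_add[OF p, of "x + t *\<^sub>R v" "y + s *\<^sub>R v"] by (simp add: algebra_simps)
    qed
    then have "flatten p v (x + y) - flatten p v y \<le> flatten p v x"
      by (intro ge) (simp add: algebra_simps)
    then show ?thesis by simp
  qed
  have scale_le: "flatten p v (t *\<^sub>R x) \<le> t * flatten p v x" if t: "0 < t" for t x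
  proof -
    have "flatten p v (t *\<^sub>R x) / t \<le> flatten p v x"
    proof (rule ge)
      fix s :: real assume s: "0 \<le> s"
      have "flatten p v (t *\<^sub>R x) \<le> p (t *\<^sub>R x + (t * s) *\<^sub>R v) - (t * s) * p v"
        using s t by (intro le) auto
      also have "\<dots> = t * (p (x + s *\<^sub>R v) - s * p v)"
        using sublinear_scaleR[OF p, of t "x + s *\<^sub>R v"] t by (simp add: algebra_simps)
      finally show "flatten p v (t *\<^sub>R x) / t \<le> p (x + s *\<^sub>R v) - s * p v"
        using t by (simp add: field_simps)
    qed
    then show ?thesis using t by (simp add: field_simps)
  qed
  have zero: "flatten p v 0 = 0"
  proof (rule antisym)
    show "flatten p v 0 \<le> 0" using le[of 0 0] sublinear_0[OF p] by simp
    show "0 \<le> flatten p v 0" by (rule ge) (simp add: sublinear_scaleR[OF p])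
  qed
  have "flatten p v (t *\<^sub>R x) = t * flatten p v x" if t: "0 \<le> t" for t x
  proof (cases "t = 0")
    case False
    then have t: "0 < t" using t by simp
    have "flatten p v (inverse t *\<^sub>R (t *\<^sub>R x)) \<le> inverse t * flatten p v (t *\<^sub>R x)"
      using t by (intro scale_le) auto
    then have "t * flatten p v x \<le> flatten p v (t *\<^sub>R x)" using t by (simp add: field_simps)
    then show ?thesis using scale_le[OF t, of x] by simp
  qed (simp add: zero)
  then show "sublinear (flatten p v)" using add by (simp add: sublinear_def)
qed

lemma minimal_sublinear_linear:
  assumes p: "sublinear p" and min: "\<And>q. sublinear q \<Longrightarrow> (\<And>x. q x \<le> p x) \<Longrightarrow> q = p"
  shows "linear p"
proof -
  have neg: "p (- v) = - p v" for v
  proof -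
    have "flatten p v = p" using flatten[OF p] by (intro min) auto
    then show ?thesis using flatten(3)[OF p, of v] sublinear_neg[OF p, of v] by simp
  qed
  have add: "p (x + y) = p x + p y" for x y
    using sublinear_add[OF p, of x y] sublinear_add[OF p, of "- x" "- y"] neg[of "x + y"]
    by (simp add: neg)
  have "p (t *\<^sub>R x) = t *\<^sub>R p x" for t x
  proof (cases "0 \<le> t")
    case True then show ?thesis by (simp add: sublinear_scaleR[OF p])
  next
    case False
    then have "p (t *\<^sub>R x) = - p ((- t) *\<^sub>R x)" by (simp flip: neg)
    then show ?thesis using False sublinear_scaleR[OF p, of "- t" x] by simp
  qed
  with add show ?thesis by (intro linearI)
qed

text \<open>
  Zorn's lemma for the reversed pointwise order: the infimum of a chain is subadditive because two
  members of the chain can be compared, and it is finite because \<open>- p (- x)\<close> bounds it below.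
\<close>

lemma exists_minimal_sublinear:
  fixes p :: "'a::real_vector \<Rightarrow> real"
  assumes p: "sublinear p"
  shows "\<exists>m. sublinear m \<and> (\<forall>x. m x \<le> p x) \<and> (\<forall>q. sublinear q \<longrightarrow> (\<forall>x. q x \<le> m x) \<longrightarrow> q = m)"
proof -
  let ?A = "{q. sublinear q \<and> (\<forall>x. q x \<le> p x)}"
  let ?R = "\<lambda>q q'. \<forall>x. q' x \<le> (q x :: real)"
  have "\<exists>m\<in>?A. \<forall>q\<in>?A. ?R m q \<longrightarrow> q = m"
  proof (rule predicate_Zorn)
    show "partial_order_on ?A (relation_of ?R ?A)"
      by (rule partial_order_on_relation_ofI) (auto intro: order_trans intro!: ext order.antisym)
    fix C assume C: "C \<in> Chains (relation_of ?R ?A)"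
    have CA: "C \<subseteq> ?A" using C by (auto simp: Chains_def relation_of_def)
    have chain: "?R q q' \<or> ?R q' q" if "q \<in> C" "q' \<in> C" for q q'
      using C that by (auto simp: Chains_def relation_of_def)
    show "\<exists>u\<in>?A. \<forall>q\<in>C. ?R q u"
    proof (cases "C = {}")
      case True then show ?thesis using p by (intro bexI[of _ p]) auto
    next
      case False
      define u where "u x = (INF q\<in>C. q x)" for x
      have "- p (- x) \<le> q x" if "q \<in> C" for q x
      proof -
        have "sublinear q" "q (- x) \<le> p (- x)" using CA that by auto
        then show ?thesis using sublinear_neg[of q x] by linarith
      qed
      then have bdd: "bdd_below ((\<lambda>q. q x) ` C)" for x by (intro bdd_belowI2)
      have le: "u x \<le> q x" if "q \<in> C" for q x unfolding u_def using that by (intro cINF_lower bdd)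
      have ge: "c \<le> u x" if "\<And>q. q \<in> C \<Longrightarrow> c \<le> q x" for c x
        unfolding u_def using False that by (intro cINF_greatest)
      have sub: "q (x + y) \<le> q x + q y" and sc: "0 \<le> t \<Longrightarrow> q (t *\<^sub>R x) = t * q x"
        if "q \<in> C" for q x y t
        using CA that sublinear_add sublinear_scaleR by blast+
      have add: "u (x + y) \<le> u x + u y" for x y
      proof -
        have "u (x + y) - q x \<le> u y" if q: "q \<in> C" for q
        proof (rule ge)
          fix q' assume q': "q' \<in> C"
          from chain[OF q q'] show "u (x + y) - q x \<le> q' y"
          proof
            assume "?R q q'"
            then have "u (x + y) \<le> q' x + q' y" "q' x \<le> q x"
              using le[OF q', of "x + y"] sub[OF q', of x y] by auto
            then show ?thesis by linarith
          next
            assume "?R q' q"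
            then have "u (x + y) \<le> q x + q y" "q y \<le> q' y"
              using le[OF q, of "x + y"] sub[OF q, of x y] by auto
            then show ?thesis by linarith
          qed
        qed
        then have "u (x + y) - u y \<le> u x" by (intro ge) (simp add: algebra_simps)
        then show ?thesis by simp
      qed
      have scale: "u (t *\<^sub>R x) = t * u x" if t: "0 \<le> t" for t x
      proof (cases "t = 0")
        case True
        have "u 0 = (INF q\<in>C. 0)"
          unfolding u_def using sc[of _ 0 0] by (intro INF_cong) auto
        then show ?thesis using True \<open>C \<noteq> {}\<close> by simp
      next
        case False
        then have t: "0 < t" using t by simp
        show ?thesis
        proof (rule antisym)
          have "u (t *\<^sub>R x) / t \<le> u x"
          proof (rule ge)
            fix q assume q: "q \<in> C"
            have "u (t *\<^sub>R x) \<le> t * q x" using le[OF q, of "t *\<^sub>R x"] sc[OF q, of t x] t by simp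
            then show "u (t *\<^sub>R x) / t \<le> q x" using t by (simp add: field_simps)
          qed
          then show "u (t *\<^sub>R x) \<le> t * u x" using t by (simp add: field_simps)
          show "t * u x \<le> u (t *\<^sub>R x)"
          proof (rule ge)
            fix q assume q: "q \<in> C"
            show "t * u x \<le> q (t *\<^sub>R x)" using le[OF q, of x] sc[OF q, of t x] t by simp
          qed
        qed
      qed
      obtain q0 where q0: "q0 \<in> C" using False by blast
      have "u x \<le> p x" for x using le[OF q0, of x] CA q0 by (auto intro: order_trans)
      then have "u \<in> ?A" using add scale by (simp add: sublinear_def)
      then show ?thesis using le by blast
    qed
  qed
  then obtain m where m: "sublinear m" "\<And>x. m x \<le> p x"
    and min: "\<And>q. q \<in> ?A \<Longrightarrow> ?R m q \<Longrightarrow> q = m" by blast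
  have "q = m" if "sublinear q" "\<And>x. q x \<le> m x" for q
    using that m(2) by (intro min) (auto intro: order_trans)
  then show ?thesis using m by blast
qed

theorem Hahn_Banach_sublinear:
  assumes p: "sublinear p"
  shows "\<exists>F. linear F \<and> (\<forall>x. F x \<le> p x) \<and> F v = p v"
proof -
  obtain m where m: "sublinear m" "\<And>x. m x \<le> flatten p v x"
    and min: "\<And>q. sublinear q \<Longrightarrow> (\<And>x. q x \<le> m x) \<Longrightarrow> q = m"
    using exists_minimal_sublinear[OF flatten(1)[OF p, of v]] by blast
  have lin: "linear m" using minimal_sublinear_linear[OF m(1) min] by blast
  have le: "m x \<le> p x" for x using m(2)[of x] flatten(2)[OF p, of v x] by simp
  have "p v \<le> m v" using m(2)[of "- v"] flatten(3)[OF p, of v] by (simp add: linear_neg[OF lin])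
  then show ?thesis using lin le le[of v] by (intro exI[of _ m]) auto
qed

text \<open>
  The complex functional is recovered from its real part \<open>F\<close> as \<open>x \<mapsto> F x - \<i> F (\<i> x)\<close>; rotating \<open>x\<close>
  until the value is real transfers the bound.
\<close>

theorem Hahn_Banach_complex:
  fixes p :: "'a::complex_normed_vector \<Rightarrow> real"
  assumes add: "\<And>x y. p (x + y) \<le> p x + p y" and scale: "\<And>c x. p (c *\<^sub>C x) = cmod c * p x"
  shows "\<exists>f. (\<forall>x y. f (x + y) = f x + f y) \<and> (\<forall>c x. f (c *\<^sub>C x) = c * f x) \<and>
    (\<forall>x. cmod (f x) \<le> p x) \<and> f v = complex_of_real (p v)"
proof -
  have sR: "r *\<^sub>R x = complex_of_real r *\<^sub>C x" for r and x :: 'a by (simp add: scaleC_of_real)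
  have "sublinear p" unfolding sublinear_def sR using add scale by simp
  then obtain F where lin: "linear F" and le: "\<And>x. F x \<le> p x" and Fv: "F v = p v"
    using Hahn_Banach_sublinear by blast
  define f where "f x = Complex (F x) (- F (\<i> *\<^sub>C x))" for x
  have fadd: "f (x + y) = f x + f y" for x y
    by (simp add: f_def scaleC_add_right linear_add[OF lin] complex_eq_iff)
  have fscale: "f (c *\<^sub>C x) = c * f x" for c x
  proof -
    have e: "c *\<^sub>C x = Re c *\<^sub>R x + Im c *\<^sub>R (\<i> *\<^sub>C x)" for x
      by (metis (no_types) complex_eq mult.commute scaleC_add_left scaleC_of_real scaleC_scaleC)
    have i: "\<i> *\<^sub>C c *\<^sub>C x = Re c *\<^sub>R (\<i> *\<^sub>C x) - Im c *\<^sub>R x"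
    proof -
      have "\<i> *\<^sub>C c *\<^sub>C x = c *\<^sub>C (\<i> *\<^sub>C x)" by (simp add: scaleC_scaleC mult.commute)
      also have "\<dots> = Re c *\<^sub>R (\<i> *\<^sub>C x) + Im c *\<^sub>R ((-1) *\<^sub>R x)"
        unfolding e[of "\<i> *\<^sub>C x"] by (simp only: scaleC_scaleC i_squared) (simp flip: scaleC_of_real)
      finally show ?thesis by simp
    qed
    show ?thesis
      unfolding f_def i
      by (subst e) (simp add: linear_add[OF lin] linear_diff[OF lin] linear_scale[OF lin] complex_eq_iff algebra_simps)
  qed
  have bound: "cmod (f x) \<le> p x" for x
  proof (cases "f x = 0")
    case True
    have "0 \<le> p x" using add[of x "(-1) *\<^sub>C x"] scale[of "-1" x] scale[of 0 x]
      by (simp add: scaleC_of_real[of "-1", simplified] scaleC_of_real[of 0, simplified])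
    then show ?thesis using True by simp
  next
    case False
    define u where "u = cnj (f x) / of_real (cmod (f x))"
    have u: "cmod u = 1" using False by (simp add: u_def norm_divide)
    have "u * f x = of_real (cmod (f x))"
      using False complex_norm_square[of "f x"] by (simp add: u_def power2_eq_square field_simps)
    then have "f (u *\<^sub>C x) = of_real (cmod (f x))" by (simp add: fscale)
    then have "cmod (f x) = F (u *\<^sub>C x)" by (simp add: f_def complex_eq_iff)
    then show ?thesis using le[of "u *\<^sub>C x"] u by (simp add: scale)
  qed
  have "f v = of_real (p v)"
  proof -
    have "Re (f v) = p v" by (simp add: f_def Fv)
    moreover from this have "Im (f v) = 0"
      using bound[of v] abs_Re_le_cmod[of "f v"] cmod_power2[of "f v"] power_mono[OF bound[of v], of 2]
      by simp
    ultimately show ?thesis by (simp add: complex_eq_iff)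
  qed
  then show ?thesis using fadd fscale bound by blast
qed

text \<open>
  Hahn--Banach for the distance to \<open>E\<close>, which is a seminorm below the norm that vanishes on \<open>E\<close>.
\<close>

lemma distance_functional_subspace:
  fixes E :: "'a::complex_normed_vector set"
  assumes E: "complex_vector.subspace E" and d: "0 \<le> d" "\<And>y. y \<in> E \<Longrightarrow> d \<le> norm (v - y)"
  shows "\<exists>f. cfunctional 1 f \<and> (\<forall>y\<in>E. f y = 0) \<and> f v = of_real d"
proof -
  have E0: "0 \<in> E" by (rule complex_vector.subspace_0[OF E])
  define p where "p x = (INF y\<in>E. norm (x - y))" for x
  have bdd: "bdd_below ((\<lambda>y. norm (x - y)) ` E)" for x by (intro bdd_belowI2[of _ 0]) auto
  have le: "p x \<le> norm (x - y)" if "y \<in> E" for x y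
    unfolding p_def using that by (intro cINF_lower bdd)
  have ge: "c \<le> p x" if "\<And>y. y \<in> E \<Longrightarrow> c \<le> norm (x - y)" for c x
    unfolding p_def using E0 that by (intro cINF_greatest) auto
  have p_nonneg: "0 \<le> p x" for x by (rule ge) simp
  have p_norm: "p x \<le> norm x" for x using le[OF E0, of x] by simp
  have p_E: "p y = 0" if "y \<in> E" for y using le[OF that, of y] p_nonneg[of y] by simp
  have add: "p (x + x') \<le> p x + p x'" for x x'
  proof -
    have "p (x + x') - norm (x - y) \<le> p x'" if y: "y \<in> E" for y
    proof (rule ge)
      fix y' assume "y' \<in> E"
      then have "p (x + x') \<le> norm ((x - y) + (x' - y'))"
        using le[OF complex_vector.subspace_add[OF E y], of y' "x + x'"] by (simp add: algebra_simps)
      then show "p (x + x') - norm (x - y) \<le> norm (x' - y')"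
        using norm_triangle_ineq[of "x - y" "x' - y'"] by linarith
    qed
    then have "p (x + x') - p x' \<le> p x" by (intro ge) (simp add: algebra_simps)
    then show ?thesis by simp
  qed
  have scale_le: "p (c *\<^sub>C x) \<le> cmod c * p x" for c x
  proof (cases "c = 0")
    case True
    then show ?thesis using p_E[OF E0] by (simp add: complex_vector.scale_zero_left)
  next
    case False
    have "p (c *\<^sub>C x) / cmod c \<le> p x"
    proof (rule ge)
      fix y assume "y \<in> E"
      then have "p (c *\<^sub>C x) \<le> norm (c *\<^sub>C x - c *\<^sub>C y)"
        by (intro le complex_vector.subspace_scale[OF E])
      also have "\<dots> = cmod c * norm (x - y)"
        by (simp add: norm_scaleC flip: complex_vector.scale_right_diff_distrib)
      finally show "p (c *\<^sub>C x) / cmod c \<le> norm (x - y)" using False by (simp add: field_simps)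
    qed
    then show ?thesis using False by (simp add: field_simps)
  qed
  have scale: "p (c *\<^sub>C x) = cmod c * p x" for c x
  proof (cases "c = 0")
    case True
    then show ?thesis using p_E[OF E0] by (simp add: complex_vector.scale_zero_left)
  next
    case False
    have "p (inverse c *\<^sub>C (c *\<^sub>C x)) \<le> cmod (inverse c) * p (c *\<^sub>C x)" by (rule scale_le)
    then have "cmod c * p x \<le> p (c *\<^sub>C x)"
      using False by (simp add: scaleC_scaleC scaleC_one norm_divide field_simps)
    then show ?thesis using scale_le[of c x] by simp
  qed
  obtain h where h: "\<And>x y. h (x + y) = h x + h y" "\<And>c x. h (c *\<^sub>C x) = c * h x"
    "\<And>x. cmod (h x) \<le> p x" "h v = complex_of_real (p v)"
    using Hahn_Banach_complex[OF add scale, of v] by blast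
  have dp: "d \<le> p v" by (rule ge) (rule d(2))
  define f where "f x = of_real (d / p v) * h x" for x
  have "cmod (f x) \<le> 1 * norm x" for x
  proof -
    have "cmod (f x) = (d / p v) * cmod (h x)"
      using d(1) p_nonneg[of v] by (simp add: f_def norm_mult norm_divide)
    also have "\<dots> \<le> 1 * p x"
      using h(3)[of x] d(1) dp p_nonneg by (intro mult_mono) (auto simp: divide_le_eq_1)
    finally show ?thesis using p_norm[of x] by simp
  qed
  then have "cfunctional 1 f" by (simp add: cfunctional_def f_def h distrib_left add_divide_distrib mult_ac)
  moreover have "f y = 0" if "y \<in> E" for y using h(3)[of y] p_E[OF that] by (simp add: f_def)
  moreover have "f v = of_real d" using d(1) dp by (simp add: f_def h(4))
  ultimately show ?thesis by blast
qed

section \<open>Bounded biorthogonal systems with a total completion\<close>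

lemma lepoll_iff_card_of: "A \<lesssim> B \<longleftrightarrow> (card_of A, card_of B) \<in> ordLeq"
  by (simp add: lepoll_def card_of_ordLeq)

lemma infinite_times_lepoll: "infinite C \<Longrightarrow> A \<lesssim> C \<Longrightarrow> B \<lesssim> C \<Longrightarrow> A \<times> B \<lesssim> C"
  unfolding lepoll_iff_card_of
  using card_of_Times_ordLeq_infinite_Field[of "card_of C" A B] card_of_card_order_on[of C] by (simp add: Field_card_of)

lemma infinite_UN_lepoll: "infinite B \<Longrightarrow> I \<lesssim> B \<Longrightarrow> (\<And>i. i \<in> I \<Longrightarrow> A i \<lesssim> B) \<Longrightarrow> (\<Union>i\<in>I. A i) \<lesssim> B"
  unfolding lepoll_iff_card_of by (rule card_of_UNION_ordLeq_infinite) auto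

lemma countable_lepoll_infinite: "countable A \<Longrightarrow> infinite B \<Longrightarrow> A \<lesssim> B"
proof -
  assume "countable A" "infinite B"
  then have "A \<lesssim> (UNIV :: nat set)" "(UNIV :: nat set) \<lesssim> B"
    by (auto simp: countable_def lepoll_def infinite_le_lepoll[unfolded lepoll_def])
  then show ?thesis by (rule lepoll_trans)
qed

lemma infinite_lepoll_Diff_finite:
  assumes "finite A" "infinite S" shows "S \<lesssim> S - A"
proof -
  have "infinite B \<Longrightarrow> A \<union> B \<lesssim> B" for B :: "'a set"
    using \<open>finite A\<close>
  proof (induction A)
    case (insert x A)
    then show ?case
      using infinite_insert_lepoll[of "A \<union> B" x] by (auto intro: lepoll_trans)
  qed simp
  from this[of "S - A"] have "A \<union> (S - A) \<lesssim> S - A" using assms by simp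
  moreover have "S \<lesssim> A \<union> (S - A)" by (rule subset_imp_lepoll) auto
  ultimately show ?thesis by (rule lepoll_trans[rotated])
qed

text \<open>
  Combinations with coefficients in a countable set \<open>Q\<close>. They are dense in the linear span when \<open>Q\<close> is
  dense, but for infinite \<open>S\<close> there are only as many of them as elements of \<open>S\<close>.
\<close>

inductive_set qspan :: "complex set \<Rightarrow> 'a::complex_normed_vector set \<Rightarrow> 'a set" for Q S where
  zero: "0 \<in> qspan Q S"
| step: "y \<in> qspan Q S \<Longrightarrow> q \<in> Q \<Longrightarrow> s \<in> S \<Longrightarrow> y + q *\<^sub>C s \<in> qspan Q S"

lemma qspan_empty: "qspan Q {} = {0}"
  by (auto intro: qspan.zero elim: qspan.cases)

lemma qspan_lepoll:
  fixes S :: "'a::complex_normed_vector set"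
  assumes Q: "countable Q" and S: "infinite S"
  shows "qspan Q S \<lesssim> S"
proof -
  define A where "A = rec_nat {0} (\<lambda>_ B. (\<lambda>(y, q, s). y + q *\<^sub>C s) ` (B \<times> Q \<times> S))"
  have A0: "A 0 = {0}" and AS: "A (Suc n) = (\<lambda>(y, q, s). y + q *\<^sub>C s) ` (A n \<times> Q \<times> S)" for n
    by (simp_all add: A_def)
  have QS: "Q \<lesssim> S" using Q S by (rule countable_lepoll_infinite)
  have "A n \<lesssim> S" for n
  proof (induction n)
    case 0
    show ?case unfolding A0 using S by (simp add: finite_lepoll_infinite)
  next
    case (Suc n)
    have "A n \<times> Q \<times> S \<lesssim> S" by (intro infinite_times_lepoll S Suc QS lepoll_refl)
    then show ?case unfolding AS by (rule lepoll_trans[OF image_lepoll])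
  qed
  moreover have "(UNIV :: nat set) \<lesssim> S" using S infinite_le_lepoll by blast
  ultimately have "(\<Union>n\<in>UNIV. A n) \<lesssim> S" using S by (intro infinite_UN_lepoll) auto
  moreover have "qspan Q S \<subseteq> (\<Union>n\<in>UNIV. A n)"
  proof
    fix x assume "x \<in> qspan Q S"
    then show "x \<in> (\<Union>n\<in>UNIV. A n)"
    proof induction
      case zero
      have "0 \<in> A 0" by (simp add: A0)
      then show ?case by blast
    next
      case (step y q s)
      then obtain n where "y \<in> A n" by blast
      then have "(y, q, s) \<in> A n \<times> Q \<times> S" using step by blast
      then have "y + q *\<^sub>C s \<in> A (Suc n)" unfolding AS by (metis (mono_tags, lifting) case_prod_conv image_eqI)
      then show ?case by blast
    qed
  qed
  ultimately show ?thesis using lepoll_trans subset_imp_lepoll by blast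
qed

lemma bounded_linear_scaleC_left: "bounded_linear (\<lambda>c. c *\<^sub>C (x :: 'a::complex_normed_vector))"
proof (rule bounded_linear_intro[where K = "norm x"])
  show "(r *\<^sub>R c) *\<^sub>C x = r *\<^sub>R (c *\<^sub>C x)" for r c
    by (metis scaleC_of_real scaleC_scaleC scaleR_conv_of_real)
qed (simp_all add: scaleC_add_left norm_scaleC)

lemma compact_bounded_combinations:
  fixes S :: "'a::complex_normed_vector set"
  assumes "finite S"
  shows "compact {\<Sum>s\<in>S. c s *\<^sub>C s |c. \<forall>s\<in>S. cmod (c s) \<le> R}"
  using assms
proof (induction S)
  case empty
  show ?case by simp
next
  case (insert t S)
  let ?A = "{\<Sum>s\<in>S. c s *\<^sub>C s |c. \<forall>s\<in>S. cmod (c s) \<le> R}"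
  let ?B = "(\<lambda>c. c *\<^sub>C t) ` cball 0 R"
  have "compact ?B"
    by (intro compact_continuous_image linear_continuous_on bounded_linear_scaleC_left compact_cball)
  then have "compact {x + y |x y. x \<in> ?B \<and> y \<in> ?A}" using insert.IH by (intro compact_sums)
  moreover have "{x + y |x y. x \<in> ?B \<and> y \<in> ?A}
      = {\<Sum>s\<in>insert t S. c s *\<^sub>C s |c. \<forall>s\<in>insert t S. cmod (c s) \<le> R}"
  proof (intro set_eqI iffI; clarsimp)
    fix d c assume "cmod d \<le> R" "\<forall>s\<in>S. cmod (c s) \<le> R"
    moreover have "(\<Sum>s\<in>S. (c(t := d)) s *\<^sub>C s) = (\<Sum>s\<in>S. c s *\<^sub>C s)"
      using insert.hyps by (intro sum.cong) auto
    ultimately show "\<exists>c'. d *\<^sub>C t + (\<Sum>s\<in>S. c s *\<^sub>C s) = (\<Sum>s\<in>insert t S. c' s *\<^sub>C s)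
        \<and> cmod (c' t) \<le> R \<and> (\<forall>s\<in>S. cmod (c' s) \<le> R)"
      using insert.hyps by (intro exI[of _ "c(t := d)"]) auto
  next
    fix c assume "cmod (c t) \<le> R" "\<forall>s\<in>S. cmod (c s) \<le> R"
    then show "\<exists>x y. (\<Sum>s\<in>insert t S. c s *\<^sub>C s) = x + y \<and> x \<in> (\<lambda>c. c *\<^sub>C t) ` cball 0 R
        \<and> (\<exists>c. y = (\<Sum>s\<in>S. c s *\<^sub>C s) \<and> (\<forall>s\<in>S. cmod (c s) \<le> R))"
      using insert.hyps
      by (intro exI[of _ "c t *\<^sub>C t"] exI[of _ "\<Sum>s\<in>S. c s *\<^sub>C s"] conjI) auto
  qed
  ultimately show ?case by simp
qed

text \<open>
  The centres have to lie in \<open>W\<close>, so the compact set that is covered is the closure of \<open>W\<close>.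
\<close>

lemma finite_half_net:
  fixes W :: "'a::metric_space set"
  assumes "W \<subseteq> C" "compact C"
  shows "\<exists>Z. finite Z \<and> Z \<subseteq> W \<and> (\<forall>w\<in>W. \<exists>z\<in>Z. dist w z < 1 / 2)"
proof -
  have "closure W \<subseteq> C" using assms compact_imp_closed closure_minimal by blast
  then have "closure W = C \<inter> closure W" by blast
  then have cpt: "compact (closure W)" using compact_Int_closed[OF assms(2) closed_closure[of W]] by simp
  have cover: "closure W \<subseteq> (\<Union>z\<in>W. ball z (1 / 2))"
  proof
    fix x assume "x \<in> closure W"
    then obtain z where "z \<in> W" "dist z x < 1 / 2"
      using closure_approachable[of x W] half_gt_zero zero_less_one by blast
    then show "x \<in> (\<Union>z\<in>W. ball z (1 / 2))" by auto
  qed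
  obtain Z where Z: "Z \<subseteq> W" "finite Z" "closure W \<subseteq> (\<Union>z\<in>Z. ball z (1 / 2))"
    using compactE_image[OF cpt _ cover] by auto
  have "\<exists>z\<in>Z. dist w z < 1 / 2" if "w \<in> W" for w
  proof -
    have "w \<in> (\<Union>z\<in>Z. ball z (1 / 2))" using Z(3) closure_subset that by blast
    then show ?thesis by (auto simp: dist_commute)
  qed
  then show ?thesis using Z by blast
qed

text \<open>
  A set \<open>V\<close> of vectors with a set \<open>D\<close> of functionals rich enough to attain distances. Two instances
  matter: all vectors and all bounded functionals, with the Gaussian rationals for \<open>Q\<close>; and the fixed
  vectors of a conjugation with the functionals commuting with it, with the rationals for \<open>Q\<close>. Stating
  the distance axiom with \<open>qspan\<close> instead of the span leaves each instance free to use its own scalars.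
\<close>

locale dual_setting =
  fixes V :: "'a::complex_normed_vector set" and D :: "('a \<Rightarrow> complex) set" and Q :: "complex set"
  assumes Q_countable: "countable Q"
    and D_functional: "f \<in> D \<Longrightarrow> \<exists>K. cfunctional K f"
    and D_zero: "(\<lambda>_. 0) \<in> D"
    and D_normalize: "f \<in> D \<Longrightarrow> v \<in> V \<Longrightarrow> (\<lambda>x. f x / f v) \<in> D"
    and V_scaleR: "v \<in> V \<Longrightarrow> r *\<^sub>R v \<in> V"
    and V_qspan: "S \<subseteq> V \<Longrightarrow> qspan Q S \<subseteq> V"
    and distance_functional: "S \<subseteq> V \<Longrightarrow> v \<in> V \<Longrightarrow> 0 \<le> d \<Longrightarrow> (\<And>y. y \<in> qspan Q S \<Longrightarrow> d \<le> norm (v - y)) \<Longrightarrow>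
      \<exists>f\<in>D. cfunctional 1 f \<and> (\<forall>s\<in>S. f s = 0) \<and> f v = of_real d"
begin

definition biorthogonal_system :: "'a set \<Rightarrow> ('a \<Rightarrow> 'a \<Rightarrow> complex) \<Rightarrow> real \<Rightarrow> bool"
  where "biorthogonal_system I f K \<longleftrightarrow> I \<subseteq> V \<and> 0 \<le> K \<and> (\<forall>i\<in>I. norm i = 1 \<and> f i \<in> D \<and> cfunctional K (f i)) \<and>
    (\<forall>i\<in>I. \<forall>j\<in>I. f i j = (if i = j then 1 else 0))"

definition total :: "('a \<Rightarrow> complex) set \<Rightarrow> bool"
  where "total \<Gamma> \<longleftrightarrow> (\<forall>v\<in>V. (\<forall>f\<in>\<Gamma>. f v = 0) \<longrightarrow> v = 0)"

lemma normalize_vector: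
  assumes "v \<in> V" "v \<noteq> 0" shows "(1 / norm v) *\<^sub>R v \<in> V" "norm ((1 / norm v) *\<^sub>R v) = 1"
  using assms V_scaleR by auto

text \<open>
  In a total set of least cardinality no functional can be omitted, so each one is nonzero at some
  common zero of the others; these vectors are the dual system.
\<close>

lemma biorthogonal_system_of_finite_total:
  assumes "finite \<Gamma>0" "\<Gamma>0 \<subseteq> D" "total \<Gamma>0"
  shows "\<exists>I f K. biorthogonal_system I f K \<and> finite I \<and> total (f ` I)"
proof -
  let ?P = "\<lambda>n. \<exists>\<Gamma>. finite \<Gamma> \<and> \<Gamma> \<subseteq> D \<and> total \<Gamma> \<and> card \<Gamma> = n"
  have "?P (LEAST n. ?P n)" by (rule LeastI_ex) (use assms in blast)
  then obtain \<Gamma> where \<Gamma>: "finite \<Gamma>" "\<Gamma> \<subseteq> D" "total \<Gamma>" and card: "card \<Gamma> = (LEAST n. ?P n)" by blast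
  have "\<not> total (\<Gamma> - {\<gamma>})" if "\<gamma> \<in> \<Gamma>" for \<gamma>
  proof
    assume "total (\<Gamma> - {\<gamma>})"
    then have "?P (card (\<Gamma> - {\<gamma>}))" using \<Gamma> by blast
    then have "(LEAST n. ?P n) \<le> card (\<Gamma> - {\<gamma>})" by (rule Least_le)
    then show False using that \<Gamma>(1) card by (metis card_Diff1_less not_le)
  qed
  then have "\<forall>\<gamma>\<in>\<Gamma>. \<exists>v. v \<in> V \<and> v \<noteq> 0 \<and> (\<forall>f\<in>\<Gamma> - {\<gamma>}. f v = 0)" unfolding total_def by blast
  then obtain v where v: "\<And>\<gamma>. \<gamma> \<in> \<Gamma> \<Longrightarrow> v \<gamma> \<in> V" "\<And>\<gamma>. \<gamma> \<in> \<Gamma> \<Longrightarrow> v \<gamma> \<noteq> 0"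
    "\<And>\<gamma> f. \<gamma> \<in> \<Gamma> \<Longrightarrow> f \<in> \<Gamma> - {\<gamma>} \<Longrightarrow> f (v \<gamma>) = 0"
    by metis
  define e where "e \<gamma> = (1 / norm (v \<gamma>)) *\<^sub>R v \<gamma>" for \<gamma>
  have e: "e \<gamma> \<in> V" "norm (e \<gamma>) = 1" if "\<gamma> \<in> \<Gamma>" for \<gamma>
    using normalize_vector[OF v(1,2)] that by (auto simp: e_def)
  have e0: "f (e \<gamma>) = 0" if fg: "f \<in> \<Gamma>" "\<gamma> \<in> \<Gamma>" "f \<noteq> \<gamma>" for f \<gamma>
  proof -
    obtain K where "cfunctional K f" using D_functional \<Gamma>(2) fg by blast
    then show ?thesis using v(3)[OF fg(2)] fg by (simp add: e_def cfunctional_scaleR)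
  qed
  have e1: "\<gamma> (e \<gamma>) \<noteq> 0" if g: "\<gamma> \<in> \<Gamma>" for \<gamma>
  proof
    assume "\<gamma> (e \<gamma>) = 0"
    then have "\<forall>f\<in>\<Gamma>. f (e \<gamma>) = 0" using e0[OF _ g] by blast
    then have "e \<gamma> = 0" using \<Gamma>(3) e(1)[OF g] unfolding total_def by blast
    then show False using e(2)[OF g] by simp
  qed
  have inj: "inj_on e \<Gamma>" using e0 e1 by (metis inj_onI)
  define f where "f i x = inv_into \<Gamma> e i x / inv_into \<Gamma> e i i" for i x
  have fe: "f (e \<gamma>) = (\<lambda>x. \<gamma> x / \<gamma> (e \<gamma>))" if "\<gamma> \<in> \<Gamma>" for \<gamma>
    using inj that by (simp add: f_def fun_eq_iff)
  have fD: "f (e \<gamma>) \<in> D" if "\<gamma> \<in> \<Gamma>" for \<gamma>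
    unfolding fe[OF that] using D_normalize \<Gamma>(2) e that by blast
  have "\<forall>\<gamma>\<in>\<Gamma>. \<exists>K. cfunctional K (f (e \<gamma>))" using D_functional fD by blast
  then obtain k where k: "\<And>\<gamma>. \<gamma> \<in> \<Gamma> \<Longrightarrow> cfunctional (k \<gamma>) (f (e \<gamma>))" by metis
  define K where "K = (\<Sum>\<gamma>\<in>\<Gamma>. \<bar>k \<gamma>\<bar>)"
  have "k \<gamma> \<le> K" if "\<gamma> \<in> \<Gamma>" for \<gamma>
    using member_le_sum[of \<gamma> \<Gamma> "\<lambda>\<gamma>. \<bar>k \<gamma>\<bar>"] \<Gamma>(1) that by (simp add: K_def)
  then have K: "cfunctional K (f (e \<gamma>))" if "\<gamma> \<in> \<Gamma>" for \<gamma> using cfunctional_mono k that by blast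
  have K0: "0 \<le> K" by (simp add: K_def sum_nonneg)
  have "f (e \<gamma>) (e \<gamma>') = (if e \<gamma> = e \<gamma>' then 1 else 0)" if "\<gamma> \<in> \<Gamma>" "\<gamma>' \<in> \<Gamma>" for \<gamma> \<gamma>'
    using that e0 e1 inj by (auto simp: fe inj_on_eq_iff)
  then have "biorthogonal_system (e ` \<Gamma>) f K"
    using K0 K fD e unfolding biorthogonal_system_def by auto
  moreover have "total (f ` e ` \<Gamma>)"
    using \<Gamma>(3) e1 unfolding total_def by (auto simp: fe)
  ultimately show ?thesis using \<Gamma>(1) by blast
qed

text \<open>
  Biorthogonal systems as graphs, so that unions of chains make sense. The value \<open>1 / 3\<close> at \<open>e\<close> is the
  distance of a new vector from the span of the old ones that the proof below guarantees; it makes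
  all coordinate functionals bounded by \<open>3\<close> after normalization.
\<close>

definition third_system :: "('a \<times> ('a \<Rightarrow> complex)) set \<Rightarrow> bool"
  where "third_system P \<longleftrightarrow>
    (\<forall>(e, f)\<in>P. e \<in> V \<and> norm e = 1 \<and> f \<in> D \<and> cfunctional 1 f \<and> f e = 1 / 3) \<and>
    (\<forall>p\<in>P. \<forall>q\<in>P. p \<noteq> q \<longrightarrow> snd p (fst q) = 0)"

lemma exists_maximal_third_system:
  "\<exists>P. third_system P \<and> (\<forall>P'. third_system P' \<longrightarrow> P \<subseteq> P' \<longrightarrow> P' = P)"
proof -
  have "\<exists>P\<in>{P. third_system P}. \<forall>X\<in>{P. third_system P}. P \<subseteq> X \<longrightarrow> X = P"
  proof (rule Zorn_Lemma, rule ballI)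
    fix C assume C: "C \<in> chains {P. third_system P}"
    then have sys: "third_system P" if "P \<in> C" for P using that chainsD2 by blast
    have "snd p (fst q) = 0" if pq: "P \<in> C" "p \<in> P" "P' \<in> C" "q \<in> P'" "p \<noteq> q" for p q P P'
    proof -
      have "P \<subseteq> P' \<or> P' \<subseteq> P" using chainsD[OF C pq(1,3)] .
      then obtain R where "R \<in> C" "p \<in> R" "q \<in> R" using pq by blast
      then show ?thesis using sys[of R] pq(5) unfolding third_system_def by blast
    qed
    moreover have "\<forall>(e, f)\<in>\<Union>C. e \<in> V \<and> norm e = 1 \<and> f \<in> D \<and> cfunctional 1 f \<and> f e = 1 / 3"
      using sys unfolding third_system_def by blast
    ultimately show "\<Union>C \<in> {P. third_system P}" unfolding third_system_def by blast
  qed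
  then show ?thesis by blast
qed

text \<open>
  The functionals \<open>g\<close> complete the coordinate functionals to a total set. The indices in \<open>A\<close> are kept
  free; later these are the first two indices of a well-order, whose phases are to be compared without
  interference from \<open>g\<close>.
\<close>

definition completion :: "'a set \<Rightarrow> ('a \<Rightarrow> 'a \<Rightarrow> complex) \<Rightarrow> 'a set \<Rightarrow> ('a \<Rightarrow> 'a \<Rightarrow> complex) \<Rightarrow> bool"
  where "completion I f A g \<longleftrightarrow> (\<forall>i\<in>I. g i \<in> D \<and> cfunctional 1 (g i)) \<and> (\<forall>i\<in>A. g i = (\<lambda>_. 0)) \<and>
    total (f ` I \<union> g ` I)"

text \<open>
  A functional \<open>\<psi> y\<close> norming \<open>y\<close> up to a factor \<open>2\<close> shows that a vector in its kernel has at least a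
  third of its norm as distance to \<open>y\<close>. Hence, if the maximal system is infinite, its coordinate
  functionals together with one norming functional for every element of \<open>qspan Q S\<close> are total, and
  \<open>qspan_lepoll\<close> allows indexing the latter by \<open>S\<close>. If the maximal system is finite, compactness of the
  unit sphere of its span leaves finitely many norming functionals, and a finite total set has a dual
  system of its own.
\<close>

theorem exists_biorthogonal_system:
  "\<exists>I f K. biorthogonal_system I f K \<and> (finite I \<longrightarrow> total (f ` I)) \<and>
    (infinite I \<longrightarrow> (\<forall>A. finite A \<longrightarrow> (\<exists>g. completion I f A g)))"
proof -
  obtain P where P: "third_system P" and max: "\<And>P'. third_system P' \<Longrightarrow> P \<subseteq> P' \<Longrightarrow> P' = P"
    using exists_maximal_third_system by blast
  define S where "S = fst ` P"
  have Pd: "fst p \<in> V" "norm (fst p) = 1" "snd p \<in> D" "cfunctional 1 (snd p)" "snd p (fst p) = 1 / 3"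
    if "p \<in> P" for p
    using P that unfolding third_system_def by (auto simp: case_prod_beta)
  have P0: "snd p (fst q) = 0" if "p \<in> P" "q \<in> P" "p \<noteq> q" for p q
    using P that unfolding third_system_def by blast
  have SV: "S \<subseteq> V" using Pd(1) by (auto simp: S_def)
  have inj: "inj_on fst P"
  proof (rule inj_onI, rule ccontr)
    fix p q assume pq: "p \<in> P" "q \<in> P" "fst p = fst q" "p \<noteq> q"
    then have "snd p (fst p) = 0" using P0[of p q] by simp
    then show False using Pd(5)[OF pq(1)] by simp
  qed
  have no_ext: "v = 0"
    if v: "v \<in> V" "\<And>p. p \<in> P \<Longrightarrow> snd p v = 0" "\<And>y. y \<in> qspan Q S \<Longrightarrow> norm v \<le> 3 * norm (v - y)" for v
  proof (rule ccontr)
    assume v0: "v \<noteq> 0"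
    obtain h where h: "h \<in> D" "cfunctional 1 h" "\<And>s. s \<in> S \<Longrightarrow> h s = 0" "h v = of_real (norm v / 3)"
      using distance_functional[OF SV v(1), of "norm v / 3"] v(3) by force
    define e where "e = (1 / norm v) *\<^sub>R v"
    have e: "e \<in> V" "norm e = 1" using normalize_vector[OF v(1) v0] by (auto simp: e_def)
    have he: "h e = 1 / 3" using h(4) v0 by (simp add: e_def cfunctional_scaleR[OF h(2)])
    have pe: "snd p e = 0" if "p \<in> P" for p
      using v(2)[OF that] by (simp add: e_def cfunctional_scaleR[OF Pd(4)[OF that]])
    have "third_system (insert (e, h) P)"
      unfolding third_system_def using Pd P0 e h(1,2) he pe h(3) by (auto simp: S_def case_prod_beta)
    then have "(e, h) \<in> P" using max by blast
    then show False using pe[of "(e, h)"] he by simp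
  qed
  have "\<forall>y\<in>qspan Q S. \<exists>f\<in>D. cfunctional 1 f \<and> f y = of_real (norm y)"
  proof
    fix y assume "y \<in> qspan Q S"
    then have "y \<in> V" using V_qspan[OF SV] by blast
    then show "\<exists>f\<in>D. cfunctional 1 f \<and> f y = of_real (norm y)"
      using distance_functional[of "{}" y "norm y"] by (auto simp: qspan_empty)
  qed
  then obtain \<psi> where \<psi>: "\<And>y. y \<in> qspan Q S \<Longrightarrow> \<psi> y \<in> D" "\<And>y. y \<in> qspan Q S \<Longrightarrow> cfunctional 1 (\<psi> y)"
    "\<And>y. y \<in> qspan Q S \<Longrightarrow> \<psi> y y = of_real (norm y)"
    by metis
  \<comment> \<open>A vector killed by a functional that nearly norms \<open>y\<close> keeps its distance from \<open>y\<close>.\<close>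
  have far: "norm v \<le> 3 * norm (v - y)"
    if y0: "y0 \<in> qspan Q S" "\<psi> y0 v = 0" and half: "norm y \<le> 2 * cmod (\<psi> y0 y)" for v y y0
  proof -
    have "cmod (\<psi> y0 y) = cmod (\<psi> y0 (v - y))"
      using y0(2) by (simp add: cfunctional_diff[OF \<psi>(2)[OF y0(1)]])
    also have "\<dots> \<le> norm (v - y)" using cfunctional_bound[OF \<psi>(2)[OF y0(1)], of "v - y"] by simp
    finally show ?thesis using half norm_triangle_sub[of v y] by linarith
  qed
  show ?thesis
  proof (cases "finite P")
    case True
    have expand: "y = (\<Sum>p\<in>P. (3 * snd p y) *\<^sub>C fst p)" if "y \<in> qspan Q S" for y
      using that
    proof induction
      case zero
      have "snd p 0 = 0" if "p \<in> P" for p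
        by (rule cfunctional_0[OF Pd(4)[OF that]])
      then show ?case by (simp add: complex_vector.scale_zero_left)
    next
      case (step y q s)
      then obtain p0 where p0: "p0 \<in> P" "s = fst p0" by (auto simp: S_def)
      have "(3 * snd p (y + q *\<^sub>C s)) *\<^sub>C fst p
          = (3 * snd p y) *\<^sub>C fst p + (if p = p0 then q *\<^sub>C s else 0)" if p: "p \<in> P" for p
      proof -
        note c = Pd(4)[OF p]
        have "snd p s = (if p = p0 then 1 / 3 else 0)"
          using P0[OF p p0(1)] Pd(5)[OF p] p0 by auto
        then show ?thesis
          using p0 by (simp add: cfunctional_add[OF c] cfunctional_scaleC[OF c] distrib_left scaleC_add_left
              complex_vector.scale_zero_left)
      qed
      then have "(\<Sum>p\<in>P. (3 * snd p (y + q *\<^sub>C s)) *\<^sub>C fst p)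
          = (\<Sum>p\<in>P. (3 * snd p y) *\<^sub>C fst p) + (\<Sum>p\<in>P. if p = p0 then q *\<^sub>C s else 0)"
        by (simp flip: sum.distrib)
      also have "\<dots> = y + q *\<^sub>C s" using step.IH p0 True by simp
      finally show ?case by simp
    qed
    \<comment> \<open>The normalized combinations lie in a compact set, so finitely many of their norming functionals do.\<close>
    define nrm where "nrm y = (1 / norm y) *\<^sub>R y" for y :: 'a
    let ?W = "nrm ` (qspan Q S - {0})"
    let ?C = "{\<Sum>s\<in>S. c s *\<^sub>C s |c. \<forall>s\<in>S. cmod (c s) \<le> 3}"
    have sub: "?W \<subseteq> ?C"
    proof
      fix w assume "w \<in> ?W"
      then obtain y where y: "y \<in> qspan Q S" "y \<noteq> 0" and w: "w = nrm y" by blast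
      define c where "c s = 3 * snd (inv_into P fst s) (nrm y)" for s
      have cf: "c (fst p) = 3 * snd p (nrm y)" if "p \<in> P" for p
        using inj that by (simp add: c_def)
      have "nrm y = (\<Sum>p\<in>P. (3 * snd p (nrm y)) *\<^sub>C fst p)"
      proof -
        have "nrm y = (1 / norm y) *\<^sub>R (\<Sum>p\<in>P. (3 * snd p y) *\<^sub>C fst p)"
          using expand[OF y(1)] by (simp add: nrm_def)
        also have "\<dots> = (\<Sum>p\<in>P. (3 * snd p (nrm y)) *\<^sub>C fst p)"
          unfolding scaleR_sum_right
        proof (rule sum.cong[OF refl])
          fix p assume p: "p \<in> P"
          note c = Pd(4)[OF p]
          show "(1 / norm y) *\<^sub>R (3 * snd p y) *\<^sub>C fst p = (3 * snd p (nrm y)) *\<^sub>C fst p"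
            by (simp only: nrm_def cfunctional_scaleR[OF c])
              (simp add: scaleC_scaleC mult_ac flip: scaleC_of_real)
        qed
        finally show ?thesis .
      qed
      also have "\<dots> = (\<Sum>s\<in>S. c s *\<^sub>C s)"
        unfolding S_def using inj cf by (simp add: sum.reindex)
      finally have "nrm y = (\<Sum>s\<in>S. c s *\<^sub>C s)" .
      moreover have "\<forall>s\<in>S. cmod (c s) \<le> 3"
      proof
        fix s assume "s \<in> S"
        then obtain p where p: "p \<in> P" "s = fst p" by (auto simp: S_def)
        have "cmod (snd p (nrm y)) \<le> 1"
          using cfunctional_bound[OF Pd(4)[OF p(1)], of "nrm y"] y
          by (simp add: nrm_def)
        then show "cmod (c s) \<le> 3" using cf[OF p(1)] p(2) by (simp add: norm_mult)
      qed
      ultimately show "w \<in> ?C" unfolding w by blast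
    qed
    have cpt: "compact ?C" using True by (intro compact_bounded_combinations) (simp add: S_def)
    from finite_half_net[OF sub cpt]
    obtain Z where Z0: "finite Z \<and> Z \<subseteq> ?W \<and> (\<forall>w\<in>?W. \<exists>z\<in>Z. dist w z < 1 / 2)" by (rule exE)
    note Z = Z0[THEN conjunct1] Z0[THEN conjunct2, THEN conjunct1] Z0[THEN conjunct2, THEN conjunct2, rule_format]
    obtain Y where Y: "finite Y" "Y \<subseteq> qspan Q S - {0}" "Z = nrm ` Y"
      using finite_subset_image[OF Z(1,2)] by blast
    let ?\<Gamma> = "snd ` P \<union> \<psi> ` Y"
    have "total ?\<Gamma>"
      unfolding total_def
    proof (intro ballI impI)
      fix v assume v: "v \<in> V" "\<forall>f\<in>?\<Gamma>. f v = 0"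
      have "norm v \<le> 3 * norm (v - y)" if y: "y \<in> qspan Q S" for y
      proof (cases "y = 0")
        case False
        then obtain y0 where y0: "y0 \<in> Y" "dist (nrm y) (nrm y0) < 1 / 2"
          using Z(3)[of "nrm y"] y Y by blast
        then have y0': "y0 \<in> qspan Q S" "y0 \<noteq> 0" using Y by auto
        note c = \<psi>(2)[OF y0'(1)]
        have "\<psi> y0 (nrm y0) = 1"
          using y0'(2) \<psi>(3)[OF y0'(1)] by (simp add: nrm_def cfunctional_scaleR[OF c])
        then have "1 - cmod (\<psi> y0 (nrm y)) \<le> cmod (\<psi> y0 (nrm y0 - nrm y))"
          using norm_triangle_ineq2[of "\<psi> y0 (nrm y0)" "\<psi> y0 (nrm y)"] by (simp add: cfunctional_diff[OF c])
        also have "\<dots> \<le> dist (nrm y) (nrm y0)"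
          using cfunctional_bound[OF c, of "nrm y0 - nrm y"] by (simp add: dist_norm norm_minus_commute)
        finally have "1 / 2 \<le> cmod (\<psi> y0 (nrm y))" using y0 by simp
        then have "norm y \<le> 2 * cmod (\<psi> y0 y)"
          using False by (simp add: nrm_def cfunctional_scaleR[OF c] norm_mult norm_divide field_simps)
        then show ?thesis using far[OF y0'(1)] v(2) y0(1) by blast
      qed simp
      then show "v = 0" using v by (intro no_ext) auto
    qed
    moreover have "?\<Gamma> \<subseteq> D" using Pd(3) \<psi>(1) Y by (force)
    ultimately show ?thesis
      using biorthogonal_system_of_finite_total[of ?\<Gamma>] True Y(1) by blast
  next
    case False
    then have S: "infinite S" using inj by (simp add: S_def finite_image_iff)
    define f where "f s x = 3 * snd (inv_into P fst s) x" for s x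
    have fp: "f (fst p) = (\<lambda>x. snd p x / snd p (fst p))" if "p \<in> P" for p
    proof
      fix x
      have "inv_into P fst (fst p) = p" using inj that by simp
      then show "f (fst p) x = snd p x / snd p (fst p)" by (simp only: f_def Pd(5)[OF that]) simp
    qed
    have fp3: "f (fst p) x = 3 * snd p x" if "p \<in> P" for p x
      using inj that by (simp add: f_def)
    have "biorthogonal_system S f 3"
      unfolding biorthogonal_system_def
    proof (intro conjI ballI)
      show "S \<subseteq> V" by (rule SV)
      fix s assume "s \<in> S"
      then obtain p where p: "p \<in> P" "s = fst p" by (auto simp: S_def)
      show "norm s = 1" using Pd(2)[OF p(1)] p by simp
      show "f s \<in> D" unfolding p(2) fp[OF p(1)] by (rule D_normalize[OF Pd(3)[OF p(1)] Pd(1)[OF p(1)]])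
      show "cfunctional 3 (f s)"
        using Pd(4)[OF p(1)] unfolding cfunctional_def p(2) fp3[OF p(1)]
        by (auto simp: algebra_simps norm_mult)
      fix t assume "t \<in> S"
      then obtain q where q: "q \<in> P" "t = fst q" by (auto simp: S_def)
      show "f s t = (if s = t then 1 else 0)"
      proof (cases "p = q")
        case True
        then have "s = t" using p q by simp
        moreover have "f t t = 1" unfolding q(2) fp3[OF q(1)] Pd(5)[OF q(1)] by simp
        ultimately show ?thesis by simp
      next
        case False
        then have "s \<noteq> t" using inj p q by (auto simp: inj_on_eq_iff)
        then show ?thesis using P0[OF p(1) q(1) False] p q by (simp add: fp3)
      qed
    qed simp
    moreover have "\<exists>g. completion S f A g"
      if A: "finite A" for A
    proof -
      have "qspan Q S \<lesssim> S - A"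
        using qspan_lepoll[OF Q_countable S] infinite_lepoll_Diff_finite[OF A S] by (rule lepoll_trans)
      then obtain r where r: "qspan Q S \<subseteq> r ` (S - A)" unfolding lepoll_iff by (rule exE)
      define g where "g i = (if i \<in> S - A \<and> r i \<in> qspan Q S then \<psi> (r i) else (\<lambda>_. 0))" for i
      have "g i \<in> D \<and> cfunctional 1 (g i)" for i
        using \<psi>(1,2) D_zero by (simp add: g_def cfunctional_zero)
      moreover have "\<forall>i\<in>A. g i = (\<lambda>_. 0)" by (simp add: g_def)
      moreover have "total (f ` S \<union> g ` S)"
        unfolding total_def
      proof (intro ballI impI)
        fix v assume v: "v \<in> V" "\<forall>h\<in>f ` S \<union> g ` S. h v = 0"
        show "v = 0"
        proof (rule no_ext[OF v(1)])
          fix p assume p: "p \<in> P"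
          then have "f (fst p) v = 0" using v(2) by (auto simp: S_def)
          then show "snd p v = 0" using p by (simp add: fp3)
        next
          fix y assume y: "y \<in> qspan Q S"
          then obtain i where i: "i \<in> S - A" "y = r i" using r by blast
          then have "g i v = 0" using v(2) by blast
          then have "\<psi> y v = 0" using i y by (simp add: g_def)
          then show "norm v \<le> 3 * norm (v - y)"
            by (rule far[OF y]) (simp add: \<psi>(3)[OF y])
        qed
      qed
      ultimately have "completion S f A g" by (simp add: completion_def)
      then show ?thesis by blast
    qed
    ultimately show ?thesis using S by blast
  qed
qed

end

section \<open>A norm that is sharp at prescribed functionals\<close>

text \<open>
  The order \<open>lt\<close> is a well-order on \<open>I\<close> with first element \<open>a\<close> and second element \<open>b\<close>. Without any \<open>g\<close>,
  the functionals with indices \<open>a\<close> and \<open>b\<close> tie the phases of the first two coordinates to each other;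
  every later index has both \<open>a\<close> and \<open>b\<close> as predecessors, which is enough to tie its own. The two values of interest for \<open>\<zeta>\<close> are \<open>3\<i>\<close> and \<open>-3\<close>; the sign
  condition keeps \<open>f j + 2 f k\<close> and \<open>f j + \<zeta> f k\<close> from being large at the same vector.
\<close>

locale rigid_system =
  fixes I :: "'i set" and e :: "'i \<Rightarrow> 'a::complex_normed_vector"
    and f g :: "'i \<Rightarrow> 'a \<Rightarrow> complex" and lt :: "'i \<Rightarrow> 'i \<Rightarrow> bool"
    and a b :: 'i and K :: real and \<zeta> :: complex
  assumes K_nonneg: "0 \<le> K"
    and f_functional: "i \<in> I \<Longrightarrow> cfunctional K (f i)"
    and g_functional: "i \<in> I \<Longrightarrow> cfunctional 1 (g i)"
    and norm_e: "i \<in> I \<Longrightarrow> norm (e i) \<le> 1"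
    and biorthogonal: "i \<in> I \<Longrightarrow> j \<in> I \<Longrightarrow> f i (e j) = (if i = j then 1 else 0)"
    and lt_total: "i \<in> I \<Longrightarrow> j \<in> I \<Longrightarrow> i \<noteq> j \<Longrightarrow> lt i j \<or> lt j i"
    and lt_minimal: "A \<subseteq> I \<Longrightarrow> A \<noteq> {} \<Longrightarrow> \<exists>m\<in>A. \<forall>i\<in>A. \<not> lt i m"
    and lt_asym: "lt i j \<Longrightarrow> \<not> lt j i"
    and a_in: "a \<in> I" and b_in: "b \<in> I" and ab: "a \<noteq> b"
    and a_first: "i \<in> I \<Longrightarrow> i \<noteq> a \<Longrightarrow> lt a i"
    and b_second: "i \<in> I \<Longrightarrow> i \<noteq> a \<Longrightarrow> i \<noteq> b \<Longrightarrow> lt b i"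
    and g_a: "g a = (\<lambda>_. 0)" and g_b: "g b = (\<lambda>_. 0)"
    and norm_\<zeta>: "cmod \<zeta> = 3" and Re_\<zeta>: "Re \<zeta> \<le> 0"
begin

text \<open>
  Scales: the base part of the norm is at most a tenth of the old norm, so it never competes with a
  functional at its exposing vector; and \<open>\<delta>\<close> is small enough that, for the functionals \<open>g\<close> measured in
  the new norm, \<open>\<delta> g\<close> is negligible.
\<close>

definition \<eta> :: real where "\<eta> = 1 / (10 * (1 + 2 * K))"
definition \<delta> :: real where "\<delta> = \<eta> / 10000"

text \<open>
  The two moduli added to the norm ensure that \<open>base\<close> is nowhere locally the modulus of a single real
  linear map into the complex numbers.
\<close>

definition base :: "'a \<Rightarrow> real"
  where "base x = \<eta> * (norm x + cmod (f a x) + cmod (f b x))"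

text \<open>
  Multiplied by this weight, \<open>f j + z f k\<close> reaches \<open>1.001\<close> at the vector \<open>e j + u e k\<close> whose phase \<open>u\<close> aligns the
  two terms. Being just above \<open>1\<close>, it is exposed there against the coordinates \<open>f i\<close>, but only barely;
  this is what distinguishes it from them.
\<close>

definition weight :: "complex \<Rightarrow> real"
  where "weight z = 1001 / 1000 / (1 + cmod z)"

definition pair :: "complex \<Rightarrow> 'i \<Rightarrow> 'i \<Rightarrow> 'a \<Rightarrow> complex"
  where "pair z j k x = of_real (weight z) * (f j x + z * f k x + of_real \<delta> * g k x)"

definition pairs :: "('a \<Rightarrow> complex) set"
  where "pairs = {pair z j k |z j k. z \<in> {2, \<zeta>} \<and> j \<in> I \<and> k \<in> I \<and> lt j k}"

definition pieces :: "('a \<Rightarrow> real) set"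
  where "pieces = insert base ((\<lambda>h x. cmod (h x)) ` (f ` I \<union> pairs))"

definition N :: "'a \<Rightarrow> real"
  where "N x = (SUP p\<in>pieces. p x)"

lemma \<eta>_pos: "0 < \<eta>" and \<eta>_le: "\<eta> \<le> 1 / 10" and \<eta>_K: "\<eta> * (1 + 2 * K) = 1 / 10"
  using K_nonneg by (auto simp: \<eta>_def field_simps)

lemma \<delta>_pos: "0 < \<delta>" and \<delta>_le: "\<delta> \<le> 1 / 100000"
  using \<eta>_pos \<eta>_le by (auto simp: \<delta>_def)

lemma a_lt_b: "lt a b"
  using a_first[OF b_in] ab by auto

lemma lt_irrefl: "\<not> lt i i"
  using lt_asym by blast

lemma weight_pos: "0 < weight z"
  unfolding weight_def by (intro divide_pos_pos add_pos_nonneg) auto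

lemma weight_2: "weight 2 = 1001 / 3000" and weight_\<zeta>: "weight \<zeta> = 1001 / 4000"
  by (simp_all add: weight_def norm_\<zeta>)

lemma scalar_bounds:
  assumes "z \<in> {2, \<zeta>}"
  shows "weight z \<le> 1001 / 3000" "weight z * cmod z \<le> 3003 / 4000"
    "weight z * (1 + cmod z) = 1001 / 1000" "2 \<le> cmod z" "cmod z \<le> 3"
  using assms by (auto simp: weight_2 weight_\<zeta> norm_\<zeta>)

lemma pair_functional:
  assumes "z \<in> {2, \<zeta>}" "j \<in> I" "k \<in> I"
  shows "cfunctional (1 + 4 * K) (pair z j k)"
proof -
  note fj = f_functional[OF assms(2)] and fk = f_functional[OF assms(3)]
    and gk = g_functional[OF assms(3)]
  have "cmod (pair z j k x) \<le> (1 + 4 * K) * norm x" for x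
  proof -
    have "cmod (f j x + z * f k x + of_real \<delta> * g k x)
        \<le> cmod (f j x) + cmod z * cmod (f k x) + \<delta> * cmod (g k x)"
      using \<delta>_pos by (intro order_trans[OF norm_triangle_ineq] add_mono) (simp_all add: norm_mult norm_triangle_le)
    also have "\<dots> \<le> K * norm x + 3 * (K * norm x) + 1 * (1 * norm x)"
      using scalar_bounds[OF assms(1)] \<delta>_le \<delta>_pos K_nonneg
      by (intro add_mono mult_mono cfunctional_bound[OF fj] cfunctional_bound[OF fk]
          cfunctional_bound[OF gk]) auto
    also have "\<dots> = (1 + 4 * K) * norm x" by (simp add: algebra_simps)
    finally have "cmod (pair z j k x) \<le> weight z * ((1 + 4 * K) * norm x)"
      using weight_pos[of z] by (simp add: pair_def norm_mult)
    also have "\<dots> \<le> 1 * ((1 + 4 * K) * norm x)"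
      using scalar_bounds(1)[OF assms(1)] K_nonneg by (intro mult_right_mono) auto
    finally show ?thesis by simp
  qed
  then show ?thesis
    unfolding cfunctional_def pair_def
    by (auto simp: cfunctional_add[OF fj] cfunctional_add[OF fk] cfunctional_add[OF gk]
        cfunctional_scaleC[OF fj] cfunctional_scaleC[OF fk] cfunctional_scaleC[OF gk] algebra_simps)
qed

lemma functional_cases:
  assumes "h \<in> f ` I \<union> pairs"
  obtains j where "j \<in> I" "h = f j"
  | z j k where "z \<in> {2, \<zeta>}" "j \<in> I" "k \<in> I" "lt j k" "h = pair z j k"
  using assms unfolding pairs_def by blast

lemma functional_bounded:
  assumes "h \<in> f ` I \<union> pairs" shows "cfunctional (1 + 4 * K) h"
  using assms
  by (cases rule: functional_cases)
    (use K_nonneg in \<open>auto intro: pair_functional cfunctional_mono[OF f_functional]\<close>)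

lemma pieces_cases:
  assumes "p \<in> pieces"
  obtains "p = base" | h where "h \<in> f ` I \<union> pairs" "p = (\<lambda>x. cmod (h x))"
  using assms unfolding pieces_def by blast

lemma base_le_norm: "base x \<le> norm x / 10"
proof -
  have "base x \<le> \<eta> * (norm x + K * norm x + K * norm x)"
    unfolding base_def using \<eta>_pos
    by (intro mult_left_mono add_mono cfunctional_bound[OF f_functional] a_in b_in) auto
  also have "\<dots> = \<eta> * (1 + 2 * K) * norm x" by (simp add: algebra_simps)
  finally show ?thesis by (simp add: \<eta>_K)
qed

lemma piece_le_norm: assumes "p \<in> pieces" shows "p x \<le> (1 + 4 * K) * norm x"
  using assms
proof (cases rule: pieces_cases)
  case 1
  have "norm x / 10 \<le> (1 + 4 * K) * norm x"
    using K_nonneg mult_right_mono[of "1/10" "1 + 4 * K" "norm x"] by simp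
  then show ?thesis using 1 base_le_norm[of x] by simp
next
  case (2 h)
  then show ?thesis using functional_bounded cfunctional_bound by blast
qed

lemma piece_nonneg: "p \<in> pieces \<Longrightarrow> 0 \<le> p x"
  by (erule pieces_cases) (use \<eta>_pos in \<open>auto simp: base_def\<close>)

lemma piece_triangle: assumes "p \<in> pieces" shows "p (x + y) \<le> p x + p y"
  using assms
proof (cases rule: pieces_cases)
  case 1
  have "norm (x + y) + cmod (f a (x + y)) + cmod (f b (x + y))
     \<le> (norm x + norm y) + (cmod (f a x) + cmod (f a y)) + (cmod (f b x) + cmod (f b y))"
    unfolding cfunctional_add[OF f_functional[OF a_in]] cfunctional_add[OF f_functional[OF b_in]]
    by (intro add_mono norm_triangle_ineq)
  then have "\<eta> * (norm (x + y) + cmod (f a (x + y)) + cmod (f b (x + y)))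
     \<le> \<eta> * ((norm x + norm y) + (cmod (f a x) + cmod (f a y)) + (cmod (f b x) + cmod (f b y)))"
    using \<eta>_pos by (intro mult_left_mono) auto
  then show ?thesis unfolding 1 base_def by (simp add: algebra_simps)
next
  case (2 h)
  then show ?thesis
    using cfunctional_add[OF functional_bounded[OF 2(1)]] by (simp add: norm_triangle_ineq)
qed

lemma piece_scaleC: assumes "p \<in> pieces" shows "p (c *\<^sub>C x) = cmod c * p x"
  using assms
proof (cases rule: pieces_cases)
  case 1
  then show ?thesis
    by (simp add: base_def norm_scaleC norm_mult algebra_simps
        cfunctional_scaleC[OF f_functional[OF a_in]] cfunctional_scaleC[OF f_functional[OF b_in]])
next
  case (2 h)
  then show ?thesis
    using cfunctional_scaleC[OF functional_bounded[OF 2(1)]] by (simp add: norm_mult)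
qed

lemma pieces_bdd: "bdd_above ((\<lambda>p. p x) ` pieces)"
  using piece_le_norm by (auto intro!: bdd_aboveI)

lemma base_in: "base \<in> pieces" by (simp add: pieces_def)
lemma f_in: "j \<in> I \<Longrightarrow> (\<lambda>x. cmod (f j x)) \<in> pieces" by (auto simp: pieces_def)
lemma functional_in: "h \<in> f ` I \<union> pairs \<Longrightarrow> (\<lambda>x. cmod (h x)) \<in> pieces" by (auto simp: pieces_def)
lemma pair_in: "z \<in> {2, \<zeta>} \<Longrightarrow> j \<in> I \<Longrightarrow> k \<in> I \<Longrightarrow> lt j k \<Longrightarrow> pair z j k \<in> f ` I \<union> pairs"
  unfolding pairs_def by blast

lemma piece_le_N: "p \<in> pieces \<Longrightarrow> p x \<le> N x"
  unfolding N_def by (intro cSUP_upper pieces_bdd)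

lemma N_le: "(\<And>p. p \<in> pieces \<Longrightarrow> p x \<le> c) \<Longrightarrow> N x \<le> c"
  unfolding N_def by (intro cSUP_least) (use base_in in auto)

lemma f_le_N: "j \<in> I \<Longrightarrow> cmod (f j x) \<le> N x"
  using piece_le_N[OF f_in] by simp

lemma functional_le_N: "h \<in> f ` I \<union> pairs \<Longrightarrow> cmod (h x) \<le> N x"
  using piece_le_N[OF functional_in] by simp

lemma N_upper: "N x \<le> (1 + 4 * K) * norm x"
  by (intro N_le piece_le_norm)

lemma N_lower: "\<eta> * norm x \<le> N x"
proof -
  have "\<eta> * norm x \<le> base x" unfolding base_def using \<eta>_pos by (intro mult_left_mono) auto
  then show ?thesis using piece_le_N[OF base_in, of x] by simp
qed

lemma norm_le_N: "norm x \<le> N x / \<eta>"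
  using N_lower[of x] \<eta>_pos by (simp add: field_simps)

lemma N_nonneg: "0 \<le> N x"
  using piece_nonneg[OF base_in, of x] piece_le_N[OF base_in, of x] by linarith

lemma N_triangle: "N (x + y) \<le> N x + N y"
proof (rule N_le)
  fix p assume p: "p \<in> pieces"
  show "p (x + y) \<le> N x + N y"
    using piece_triangle[OF p, of x y] piece_le_N[OF p, of x] piece_le_N[OF p, of y] by linarith
qed

lemma N_scaleC_le: "N (c *\<^sub>C x) \<le> cmod c * N x"
  by (intro N_le) (simp add: piece_scaleC mult_left_mono piece_le_N)

lemma N_zero_iff: "N x = 0 \<longleftrightarrow> x = 0"
proof
  assume "N x = 0" then show "x = 0" using norm_le_N[of x] by simp
next
  assume "x = 0" then show "N x = 0" using N_upper[of x] N_nonneg[of x] by simp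
qed

lemma N_scaleC: "N (c *\<^sub>C x) = cmod c * N x"
proof (cases "c = 0")
  case True
  then show ?thesis using N_zero_iff[of 0] by simp
next
  case False
  have "N x = N (inverse c *\<^sub>C c *\<^sub>C x)" using False by (simp add: scaleC_scaleC scaleC_one)
  also have "\<dots> \<le> inverse (cmod c) * N (c *\<^sub>C x)"
    using N_scaleC_le[of "inverse c" "c *\<^sub>C x"] by (simp only: norm_inverse)
  finally have "cmod c * N x \<le> N (c *\<^sub>C x)" using False by (simp add: field_simps)
  then show ?thesis using N_scaleC_le[of c x] by simp
qed

lemma equivalent_complex_norm_N: "equivalent_complex_norm N"
proof -
  have "is_complex_norm N"
    unfolding is_complex_norm_def by (simp add: N_nonneg N_zero_iff N_triangle N_scaleC)
  moreover have "0 < 1 + 4 * K" using K_nonneg by simp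
  ultimately show ?thesis
    unfolding equivalent_complex_norm_def using \<eta>_pos N_lower N_upper by blast
qed

lemma N_scaleR: "N (r *\<^sub>R x) = \<bar>r\<bar> * N x"
  using N_scaleC[of "of_real r" x] by (simp add: scaleC_of_real)

lemma N_minus_commute: "N (x - y) = N (y - x)"
  using N_scaleR[of "-1" "x - y"] by simp

lemma piece_lipschitz: "p \<in> pieces \<Longrightarrow> p y \<le> p x + N (y - x)"
  using piece_triangle[of p x "y - x"] piece_le_N[of p "y - x"] by simp

lemma pair_approx:
  assumes "z \<in> {2, \<zeta>}" "k \<in> I"
  shows "cmod (pair z j k x - of_real (weight z) * (f j x + z * f k x)) \<le> \<delta> * norm x"
proof -
  have "pair z j k x - of_real (weight z) * (f j x + z * f k x) = of_real (weight z * \<delta>) * g k x"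
    by (simp add: pair_def algebra_simps)
  then have "cmod (pair z j k x - of_real (weight z) * (f j x + z * f k x)) = weight z * \<delta> * cmod (g k x)"
    using weight_pos[of z] \<delta>_pos by (simp add: norm_mult)
  also have "\<dots> \<le> 1 * \<delta> * (1 * norm x)"
    using scalar_bounds(1)[OF assms(1)] weight_pos[of z] \<delta>_pos
    by (intro mult_mono cfunctional_bound[OF g_functional[OF assms(2)]]) auto
  finally show ?thesis by simp
qed

lemma pair_upper:
  assumes "z \<in> {2, \<zeta>}" "k \<in> I"
  shows "cmod (pair z j k x) \<le> weight z * cmod (f j x + z * f k x) + \<delta> * norm x"
proof -
  have "cmod (pair z j k x) \<le> cmod (of_real (weight z) * (f j x + z * f k x)) + \<delta> * norm x"
    using norm_triangle_sub[of "pair z j k x" "of_real (weight z) * (f j x + z * f k x)"]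
      pair_approx[OF assms, of j x] by linarith
  then show ?thesis using weight_pos[of z] by (simp only: norm_mult) simp
qed

lemma pair_lower:
  assumes "z \<in> {2, \<zeta>}" "k \<in> I"
  shows "weight z * cmod (f j x + z * f k x) - \<delta> * norm x \<le> cmod (pair z j k x)"
proof -
  have "cmod (of_real (weight z) * (f j x + z * f k x)) \<le> cmod (pair z j k x) + \<delta> * norm x"
    using norm_triangle_sub[of "of_real (weight z) * (f j x + z * f k x)" "pair z j k x"]
      pair_approx[OF assms, of j x] by (simp add: norm_minus_commute)
  then show ?thesis using weight_pos[of z] by (simp only: norm_mult) simp
qed

lemma \<delta>_norm_le: "norm x \<le> c \<Longrightarrow> \<delta> * norm x \<le> c / 100000"
proof -
  assume "norm x \<le> c"
  then have "\<delta> * norm x \<le> 1 / 100000 * c"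
    using \<delta>_le \<delta>_pos by (intro mult_mono) auto
  then show ?thesis by simp
qed

lemma \<delta>_norm_le_N: "\<delta> * norm x \<le> N x / 10000"
  using N_lower[of x] by (simp add: \<delta>_def)

lemma expose_f:
  assumes i: "i \<in> I" and p: "p \<in> pieces" "p \<noteq> (\<lambda>x. cmod (f i x))"
  shows "p (e i) \<le> 8 / 10"
  using p(1)
proof (cases rule: pieces_cases)
  case 1
  then show ?thesis using base_le_norm[of "e i"] norm_e[OF i] by simp
next
  case (2 h)
  from 2(1) show ?thesis
  proof (cases rule: functional_cases)
    case (1 j)
    then have "j \<noteq> i" using 2 p by auto
    then show ?thesis using 1 2 i by (simp add: biorthogonal)
  next
    case (2 z j k)
    note sb = scalar_bounds[OF 2(1)]
    have "j \<noteq> k" using 2 lt_irrefl by auto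
    then have "cmod (f j (e i) + z * f k (e i)) \<le> cmod z"
      using 2 i sb by (auto simp: biorthogonal)
    then have "weight z * cmod (f j (e i) + z * f k (e i)) \<le> 3003 / 4000"
      using sb(2) weight_pos[of z] by (meson less_imp_le mult_left_mono order_trans)
    then show ?thesis
      using pair_upper[OF 2(1,3), of j "e i"] \<delta>_norm_le[OF norm_e[OF i]] 2 \<open>p = _\<close> by simp
  qed
qed

text \<open>
  At the aligned vector the coordinates are at most \<open>1\<close>. Another two-index functional either sees at
  most one of \<open>e j\<close>, \<open>e k\<close>, or has the other coefficient, whose terms are not aligned.
\<close>

lemma expose_pair:
  assumes z: "z \<in> {2, \<zeta>}" and jk: "j \<in> I" "k \<in> I" "lt j k"
  shows "\<exists>w. norm w \<le> 2 \<and> 1 + 1 / 2000 \<le> cmod (pair z j k w) \<and>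
    (\<forall>p\<in>pieces. p \<noteq> (\<lambda>x. cmod (pair z j k x)) \<longrightarrow> p w \<le> 1)"
proof -
  note sb = scalar_bounds[OF z]
  have jnk: "j \<noteq> k" using jk lt_irrefl by auto
  define u where "u = cnj z / of_real (cmod z)"
  have z0: "z \<noteq> 0" using sb by auto
  have zu: "z * u = of_real (cmod z)"
    using z0 using complex_norm_square[of z] by (simp add: u_def power2_eq_square field_simps)
  have u1: "cmod u = 1" using z0 by (simp add: u_def norm_divide)
  define w where "w = e j + u *\<^sub>C e k"
  have fw: "f i w = (if i = j then 1 else if i = k then u else 0)" if "i \<in> I" for i
    using that jk jnk
    by (simp add: w_def cfunctional_add[OF f_functional] cfunctional_scaleC[OF f_functional] biorthogonal)
  have nw: "norm w \<le> 2"
    unfolding w_def using norm_triangle_ineq[of "e j" "u *\<^sub>C e k"] norm_e[OF jk(1)] norm_e[OF jk(2)] u1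
    by (simp add: norm_scaleC)
  note dn = \<delta>_norm_le[OF nw]
  have main: "f j w + z * f k w = of_real (1 + cmod z)"
    using jk jnk by (simp add: fw zu)
  have "cmod (f j w + z * f k w) = 1 + cmod z" 
    unfolding main norm_of_real by simp
  then have big: "1 + 1 / 2000 \<le> cmod (pair z j k w)"
    using pair_lower[OF z jk(2), of j w] dn sb(3) by simp
  have small: "p w \<le> 1" if p: "p \<in> pieces" "p \<noteq> (\<lambda>x. cmod (pair z j k x))" for p
    using p(1)
  proof (cases rule: pieces_cases)
    case 1
    then show ?thesis using base_le_norm[of w] nw by simp
  next
    case (2 h)
    from 2(1) show ?thesis
    proof (cases rule: functional_cases)
      case (1 i)
      then show ?thesis using 2 u1 by (simp add: fw)
    next
      case (2 z' j' k')
      note sb' = scalar_bounds[OF 2(1)]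
      have n': "j' \<noteq> k'" using 2 lt_irrefl by auto
      have "weight z' * cmod (f j' w + z' * f k' w) \<le> 9 / 10"
      proof (cases "j' = j \<and> k' = k")
        case True
        then have eq: "cmod (f j' w + z' * f k' w) = cmod (1 + z' * u)"
          using jk jnk by (simp add: fw)
        have "z' \<noteq> z" using True 2 p \<open>p = _\<close> by auto
        then consider "z' = \<zeta>" "z = 2" | "z' = 2" "z = \<zeta>" using z 2 by auto
        then show ?thesis
        proof cases
          case 1
          have "(cmod (1 + \<zeta>))\<^sup>2 = 1 + 2 * Re \<zeta> + (cmod \<zeta>)\<^sup>2"
            unfolding cmod_power2 by (simp add: power2_eq_square algebra_simps)
          then have "(cmod (1 + \<zeta>))\<^sup>2 \<le> (32 / 10)\<^sup>2"
            using Re_\<zeta> norm_\<zeta> by (simp add: power2_eq_square)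
          then have "cmod (1 + \<zeta>) \<le> 32 / 10" by (rule power2_le_imp_le) simp
          then show ?thesis unfolding eq using 1 by (simp add: u_def weight_\<zeta>)
        next
          case 2
          have "(cmod (1 + 2 * u))\<^sup>2 = 1 + 4 * Re u + 4 * (cmod u)\<^sup>2"
            unfolding cmod_power2 by (simp add: power2_eq_square algebra_simps)
          moreover have "Re u \<le> 0" using 2 Re_\<zeta> norm_\<zeta> by (simp add: u_def)
          ultimately have "(cmod (1 + 2 * u))\<^sup>2 \<le> (23 / 10)\<^sup>2"
            using u1 by (simp add: power2_eq_square)
          then have "cmod (1 + 2 * u) \<le> 23 / 10" by (rule power2_le_imp_le) simp
          then show ?thesis unfolding eq using 2 by (simp add: weight_2)
        qed
      next
        case False
        have "\<not> (j' = k \<and> k' = j)" using jk 2 lt_asym by blast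
        then have "cmod (f j' w + z' * f k' w) \<le> cmod z'"
          using 2 False n' u1 sb'(4) by (auto simp: fw norm_mult)
        then have "weight z' * cmod (f j' w + z' * f k' w) \<le> 3003 / 4000"
          using sb'(2) weight_pos[of z'] by (meson less_imp_le mult_left_mono order_trans)
        then show ?thesis by simp
      qed
      then show ?thesis
        using pair_upper[OF 2(1,3), of j' w] dn 2 \<open>p = _\<close> by simp
    qed
  qed
  show ?thesis using nw big small by blast
qed

lemma exposure:
  assumes "h \<in> f ` I \<union> pairs"
  shows "\<exists>w. norm w \<le> 2 \<and> (\<forall>p\<in>pieces. p \<noteq> (\<lambda>x. cmod (h x)) \<longrightarrow> p w \<le> cmod (h w) - 1 / 2000)"
  using assms
proof (cases rule: functional_cases)
  case (1 j)
  have "p (e j) \<le> cmod (f j (e j)) - 1 / 2000" if "p \<in> pieces" "p \<noteq> (\<lambda>x. cmod (f j x))" for p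
    using expose_f[OF 1(1) that] 1(1) by (simp add: biorthogonal)
  moreover have "norm (e j) \<le> 2" using norm_e[OF 1(1)] by simp
  ultimately show ?thesis using 1 by blast
next
  case (2 z j k)
  obtain w where w: "norm w \<le> 2" "1 + 1 / 2000 \<le> cmod (pair z j k w)"
    "\<And>p. p \<in> pieces \<Longrightarrow> p \<noteq> (\<lambda>x. cmod (pair z j k x)) \<Longrightarrow> p w \<le> 1"
    using expose_pair[OF 2(1-4)] by blast
  have "p w \<le> cmod (pair z j k w) - 1 / 2000" if "p \<in> pieces" "p \<noteq> (\<lambda>x. cmod (pair z j k x))" for p
    using w(2) w(3)[OF that] by linarith
  then show ?thesis using w(1) 2(5) by blast
qed

text \<open>
  A real linear \<open>h\<close> has a nonzero kernel vector \<open>z\<close> in the span of \<open>e a\<close> and \<open>e b\<close>. If \<open>base = \<bar>h\<bar>\<close> on a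
  ball, then \<open>base\<close> is constant along \<open>z\<close> there, so the midpoint inequality is an equality for
  each of its convex summands. Since the modulus is strictly convex on real lines that miss the
  origin, this forces \<open>f a z = f b z = 0\<close>, which makes \<open>z\<close> vanish.
\<close>

lemma base_nowhere_modulus:
  assumes h: "linear h" and r: "0 < r"
  shows "\<exists>y. N (y - x) < r \<and> base y \<noteq> cmod (h y)"
proof (rule ccontr)
  assume "\<not> ?thesis"
  then have eq: "base y = cmod (h y)" if "N (y - x) < r" for y using that by blast
  obtain s t where st: "(s, t) \<noteq> (0, 0)" and h0: "h (s *\<^sub>C e a + t *\<^sub>C e b) = 0"
    using two_dim_kernel[OF h] by blast
  define z where "z = s *\<^sub>C e a + t *\<^sub>C e b"
  note fa = f_functional[OF a_in] and fb = f_functional[OF b_in]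
  have fz: "f a z = s" "f b z = t"
    using a_in b_in ab
    by (auto simp: z_def cfunctional_add[OF fa] cfunctional_add[OF fb]
        cfunctional_scaleC[OF fa] cfunctional_scaleC[OF fb] biorthogonal)
  define \<tau> where "\<tau> = r / (2 * (N z + 1))"
  have \<tau>: "0 < \<tau>" and \<tau>z: "\<tau> * N z < r / 2"
    using r N_nonneg[of z] by (auto simp: \<tau>_def field_simps)
  have flat: "cmod (f c (y + \<tau> *\<^sub>R z)) + cmod (f c (y - \<tau> *\<^sub>R z)) = 2 * cmod (f c y)"
    if y: "N (y - x) < r / 2" and c: "c \<in> {a, b}" for y c
  proof -
    have n: "N (\<tau> *\<^sub>R z) < r / 2" using \<tau> \<tau>z by (simp add: N_scaleR)
    have "N (y + \<tau> *\<^sub>R z - x) < r" "N (y - \<tau> *\<^sub>R z - x) < r" "N (y - x) < r"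
      using N_triangle[of "y - x" "\<tau> *\<^sub>R z"] N_triangle[of "y - x" "- (\<tau> *\<^sub>R z)"] y n r
        N_minus_commute[of 0 "\<tau> *\<^sub>R z"]
      by (simp_all add: algebra_simps)
    then have "base (y + \<tau> *\<^sub>R z) + base (y - \<tau> *\<^sub>R z) = 2 * base y"
      using h0 by (simp add: eq linear_add[OF h] linear_diff[OF h] linear_scale[OF h] z_def)
    then have "\<eta> * (norm (y + \<tau> *\<^sub>R z) + norm (y - \<tau> *\<^sub>R z)
          + (cmod (f a (y + \<tau> *\<^sub>R z)) + cmod (f a (y - \<tau> *\<^sub>R z)))
          + (cmod (f b (y + \<tau> *\<^sub>R z)) + cmod (f b (y - \<tau> *\<^sub>R z))))
        = \<eta> * (2 * norm y + 2 * cmod (f a y) + 2 * cmod (f b y))"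
      unfolding base_def by (simp add: algebra_simps)
    then have sum: "norm (y + \<tau> *\<^sub>R z) + norm (y - \<tau> *\<^sub>R z)
          + (cmod (f a (y + \<tau> *\<^sub>R z)) + cmod (f a (y - \<tau> *\<^sub>R z)))
          + (cmod (f b (y + \<tau> *\<^sub>R z)) + cmod (f b (y - \<tau> *\<^sub>R z)))
        = 2 * norm y + 2 * cmod (f a y) + 2 * cmod (f b y)"
      using \<eta>_pos by simp
    have mid: "2 * norm v \<le> norm (v + v') + norm (v - v')" for v v' :: "'v::real_normed_vector"
      using norm_triangle_ineq[of "v + v'" "v - v'"] by (simp flip: scaleR_2)
    have m: "2 * norm y \<le> norm (y + \<tau> *\<^sub>R z) + norm (y - \<tau> *\<^sub>R z)"
      "2 * cmod (f a y) \<le> cmod (f a (y + \<tau> *\<^sub>R z)) + cmod (f a (y - \<tau> *\<^sub>R z))"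
      "2 * cmod (f b y) \<le> cmod (f b (y + \<tau> *\<^sub>R z)) + cmod (f b (y - \<tau> *\<^sub>R z))"
      unfolding cfunctional_add[OF fa] cfunctional_add[OF fb] cfunctional_diff[OF fa]
        cfunctional_diff[OF fb] by (rule mid)+
    from c consider "c = a" | "c = b" by auto
    then show ?thesis
    proof cases
      case 1
      show ?thesis unfolding 1 using sum m by linarith
    next
      case 2
      show ?thesis unfolding 2 using sum m by linarith
    qed
  qed
  have zero: "f c z = 0" if c: "c \<in> {a, b}" for c
  proof (rule ccontr)
    assume d: "f c z \<noteq> 0"
    have cI: "c \<in> I" using c a_in b_in by auto
    note fc = f_functional[OF cI]
    have "\<exists>y. N (y - x) < r / 2 \<and> Im (f c y / f c z) \<noteq> 0"
    proof (cases "Im (f c x / f c z) = 0")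
      case False
      then show ?thesis using r N_zero_iff[of 0] by (intro exI[of _ x]) simp
    next
      case True
      define v where "v = (\<i> * f c z) *\<^sub>C e c"
      define \<sigma> where "\<sigma> = r / (4 * (N v + 1))"
      have \<sigma>: "0 < \<sigma>" "\<sigma> * N v < r / 2"
        using r N_nonneg[of v] by (auto simp: \<sigma>_def field_simps add_pos_nonneg)
      have "f c (x + \<sigma> *\<^sub>R v) / f c z = f c x / f c z + of_real \<sigma> * \<i>"
        using cI d
        by (simp add: v_def cfunctional_add[OF fc] cfunctional_scaleR[OF fc]
            cfunctional_scaleC[OF fc] biorthogonal field_simps)
      then have "Im (f c (x + \<sigma> *\<^sub>R v) / f c z) = \<sigma>" using True by simp
      then show ?thesis using \<sigma> by (intro exI[of _ "x + \<sigma> *\<^sub>R v"]) (simp add: N_scaleR)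
    qed
    then obtain y where y: "N (y - x) < r / 2" and im: "Im (f c y / f c z) \<noteq> 0" by blast
    define q where "q = f c y / f c z"
    have fy: "f c y = f c z * q" using d by (simp add: q_def)
    have "cmod (f c z) * cmod (q + of_real \<tau>) + cmod (f c z) * cmod (q - of_real \<tau>)
        = cmod (f c z) * (2 * cmod q)"
      using flat[OF y c]
      unfolding cfunctional_add[OF fc] cfunctional_diff[OF fc] cfunctional_scaleR[OF fc] fy
        norm_mult[symmetric]
      by (simp add: algebra_simps norm_mult)
    then have "cmod (q + of_real \<tau>) + cmod (q - of_real \<tau>) = 2 * cmod q"
      using d by (simp flip: distrib_left)
    then show False using strict_midpoint_complex[of q \<tau>] im \<tau> by (simp add: q_def)
  qed
  show False using zero[of a] zero[of b] fz st by simp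
qed

text \<open>
  Squared moduli of real linear maps are quadratic, so the parallelogram law reads off their values
  everywhere from three points of the ball.
\<close>

lemma modulus_eq_of_N_ball:
  assumes h: "linear h" and h0: "linear h0" and r: "0 < r"
    and eq: "\<And>y. N (y - z) < r \<Longrightarrow> cmod (h y) = cmod (h0 y)"
  shows "cmod (h v) = cmod (h0 v)"
proof -
  define \<tau> where "\<tau> = r / (2 * (N v + 1))"
  have \<tau>: "0 < \<tau>" and n: "N (\<tau> *\<^sub>R v) < r"
    using r N_nonneg[of v] by (auto simp: \<tau>_def N_scaleR field_simps add_pos_nonneg)
  have lin: "(cmod (k (z + \<tau> *\<^sub>R v)))\<^sup>2 + (cmod (k (z - \<tau> *\<^sub>R v)))\<^sup>2 = 2 * (cmod (k z))\<^sup>2 + 2 * (\<tau> * cmod (k v))\<^sup>2"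
    if k: "linear k" for k :: "'a \<Rightarrow> complex"
    using cmod_parallelogram[of "k z" "k (\<tau> *\<^sub>R v)"] \<tau>
    by (simp add: linear_add[OF k] linear_diff[OF k] linear_scale[OF k])
  have "N (z + \<tau> *\<^sub>R v - z) < r" "N (z - \<tau> *\<^sub>R v - z) < r" "N (z - z) < r"
    using n r N_zero_iff[of 0] N_minus_commute[of "\<tau> *\<^sub>R v" 0] by simp_all
  note eq[OF this(1)] eq[OF this(2)] eq[OF this(3)]
  then have "(\<tau> * cmod (h v))\<^sup>2 = (\<tau> * cmod (h0 v))\<^sup>2"
    using lin[OF h] lin[OF h0] by simp
  then show ?thesis using \<tau> by (simp add: power_mult_distrib)
qed

lemma dominant_piece:
  assumes p0: "p0 \<in> pieces" and dom: "\<And>p. p \<in> pieces \<Longrightarrow> p \<noteq> p0 \<Longrightarrow> p z + 2 * \<rho> \<le> p0 z"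
    and v: "N (v - z) < \<rho>"
  shows "N v = p0 v"
proof (rule antisym)
  have lower: "p0 z \<le> p0 v + N (v - z)"
    using piece_lipschitz[OF p0, of z v] N_minus_commute[of z v] by simp
  show "N v \<le> p0 v"
  proof (rule N_le)
    fix p assume p: "p \<in> pieces"
    show "p v \<le> p0 v"
    proof (cases "p = p0")
      case False
      show ?thesis using piece_lipschitz[OF p, of v z] dom[OF p False] lower v by simp
    qed simp
  qed
  show "p0 v \<le> N v" by (rule piece_le_N[OF p0])
qed

text \<open>
  At some point of the ball \<open>base\<close> is not active, so members of the family come arbitrarily close to \<open>N\<close>.
  Moving a little along the exposing vector of such a member \<open>h0\<close> makes it dominate strictly, so that
  \<open>\<bar>h\<bar> = N = \<bar>h0\<bar>\<close> on a smaller ball. The supremum need not be attained, which is why the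
  gap \<open>\<epsilon>\<close> is chosen after the step length \<open>t\<close>.
\<close>

lemma N_local_modulus:
  assumes h: "linear h" and r: "0 < r"
    and eq: "\<And>y. N (y - x) < r \<Longrightarrow> N y = cmod (h y)"
  shows "\<exists>h0 \<in> f ` I \<union> pairs. \<forall>y. cmod (h y) = cmod (h0 y)"
proof -
  obtain y where y: "N (y - x) < r" and "base y \<noteq> cmod (h y)"
    using base_nowhere_modulus[OF h r] by blast
  then have base_lt: "base y < N y" using eq[OF y] piece_le_N[OF base_in, of y] by simp
  define W where "W = 2 * (1 + 4 * K)"
  have W: "0 < W" using K_nonneg by (simp add: W_def)
  define s where "s = r - N (y - x)"
  have s: "0 < s" using y by (simp add: s_def)
  define t where "t = s / (2 * (W + 1))"
  have t: "0 < t" using s W by (simp add: t_def)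
  have "t * (W + 1) = s / 2" using W by (simp add: t_def field_simps)
  then have tW: "t * W + t \<le> s / 2" by (simp add: algebra_simps)
  define \<epsilon> where "\<epsilon> = min (t / 4000) (N y - base y)"
  have \<epsilon>: "0 < \<epsilon>" using t base_lt by (simp add: \<epsilon>_def)
  have "N y - \<epsilon> < (SUP p\<in>pieces. p y)" using \<epsilon> by (simp add: N_def)
  then obtain p0 where p0: "p0 \<in> pieces" "N y - \<epsilon> < p0 y"
    using less_cSUP_iff[OF _ pieces_bdd] base_in by blast
  have "p0 \<noteq> base" using p0(2) by (auto simp: \<epsilon>_def)
  then obtain h0 where h0: "h0 \<in> f ` I \<union> pairs" and p0h: "p0 = (\<lambda>x. cmod (h0 x))"
    using p0(1) by (blast elim: pieces_cases)
  note h0f = functional_bounded[OF h0]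
  obtain w where w: "norm w \<le> 2"
    and expose: "\<And>p. p \<in> pieces \<Longrightarrow> p \<noteq> p0 \<Longrightarrow> p w \<le> cmod (h0 w) - 1 / 2000"
    using exposure[OF h0] p0h by blast
  have Nw: "N w \<le> W"
    using N_upper[of w] mult_left_mono[OF w, of "1 + 4 * K"] K_nonneg by (simp add: W_def)
  obtain u where u: "cmod u = 1" "cmod (h0 y + u * (t * h0 w)) = cmod (h0 y) + cmod (t * h0 w)"
    using exists_aligning_phase by blast
  define z where "z = y + (u * of_real t) *\<^sub>C w"
  have h0z: "cmod (h0 z) = cmod (h0 y) + t * cmod (h0 w)"
    using u(2) t
    by (simp add: z_def cfunctional_add[OF h0f] cfunctional_scaleC[OF h0f] mult.assoc norm_mult)
  have other: "p z \<le> cmod (h0 z) - t / 4000" if p: "p \<in> pieces" "p \<noteq> p0" for p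
  proof -
    have "p z \<le> p y + t * p w"
      using piece_triangle[OF p(1), of y "(u * of_real t) *\<^sub>C w"] t u(1)
      by (simp add: z_def piece_scaleC[OF p(1)] norm_mult)
    also have "\<dots> \<le> N y + t * (cmod (h0 w) - 1 / 2000)"
      using piece_le_N[OF p(1)] expose[OF p] t by (intro add_mono mult_left_mono) auto
    also have "\<dots> = N y + t * cmod (h0 w) - t / 2000" by (simp add: algebra_simps)
    finally have "p z \<le> N y + t * cmod (h0 w) - t / 2000" .
    moreover have "N y - t / 4000 \<le> cmod (h0 y)" using p0(2) by (simp add: p0h \<epsilon>_def)
    ultimately show ?thesis unfolding h0z by linarith
  qed
  define \<rho> where "\<rho> = t / 8000"
  have Nh0: "N v = cmod (h0 v)" if v: "N (v - z) < \<rho>" for v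
  proof -
    have "p z + 2 * \<rho> \<le> p0 z" if "p \<in> pieces" "p \<noteq> p0" for p
      using other[OF that] by (simp add: p0h \<rho>_def)
    then show ?thesis using dominant_piece[of p0 z \<rho> v, OF p0(1) _ v] by (simp add: p0h)
  qed
  have "cmod (h v) = cmod (h0 v)" if v: "N (v - z) < \<rho>" for v
  proof -
    have "N (z - y) = t * N w" using t u(1) by (simp add: z_def N_scaleC norm_mult)
    also have "\<dots> \<le> t * W" using Nw t by (intro mult_left_mono) auto
    finally have "N (z - y) \<le> t * W" .
    moreover have "N (v - x) \<le> N (v - z) + N (z - y) + N (y - x)"
      using N_triangle[of "v - z" "z - y"] N_triangle[of "v - y" "y - x"] by simp
    moreover have "\<rho> \<le> t" using t by (simp add: \<rho>_def)
    ultimately have "N (v - x) < r" using v tW s by (simp add: s_def)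
    then show ?thesis using eq Nh0[OF v] by simp
  qed
  moreover have "0 < \<rho>" using t by (simp add: \<rho>_def)
  ultimately have "cmod (h v) = cmod (h0 v)" for v
    using modulus_eq_of_N_ball[OF h cfunctional_linear[OF h0f]] by blast
  then show ?thesis using h0 by blast
qed

text \<open>
  A scale-invariant measure of exposure: the ball on which \<open>N = \<bar>h\<bar>\<close> has radius a tenth of the norm of
  its centre. It separates the coordinates from the two-index functionals.
\<close>

definition sharp :: "('a \<Rightarrow> complex) \<Rightarrow> bool"
  where "sharp h \<longleftrightarrow> (\<exists>x. x \<noteq> 0 \<and> (\<forall>y. N (y - x) < N x / 10 \<longrightarrow> N y = cmod (h y)))"

lemma sharp_cong: "(\<And>x. cmod (h x) = cmod (h' x)) \<Longrightarrow> sharp h \<longleftrightarrow> sharp h'"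
  by (simp add: sharp_def)

lemma N_e: assumes j: "j \<in> I" shows "N (e j) = 1"
proof (rule antisym)
  show "N (e j) \<le> 1"
  proof (rule N_le)
    fix p assume p: "p \<in> pieces"
    show "p (e j) \<le> 1"
    proof (cases "p = (\<lambda>x. cmod (f j x))")
      case True then show ?thesis using j by (simp add: biorthogonal)
    next
      case False then show ?thesis using expose_f[OF j p False] by simp
    qed
  qed
  show "1 \<le> N (e j)" using f_le_N[OF j, of "e j"] j by (simp add: biorthogonal)
qed

lemma sharp_f: assumes j: "j \<in> I" shows "sharp (f j)"
  unfolding sharp_def
proof (intro exI[of _ "e j"] conjI allI impI)
  show "e j \<noteq> 0" using N_e[OF j] N_zero_iff by force
  fix y assume "N (y - e j) < N (e j) / 10"
  then have y: "N (y - e j) < 1 / 10" by (simp add: N_e[OF j])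
  have "p (e j) + 2 * (1 / 10) \<le> cmod (f j (e j))" if "p \<in> pieces" "p \<noteq> (\<lambda>x. cmod (f j x))" for p
    using expose_f[OF j that] j by (simp add: biorthogonal)
  then show "N y = cmod (f j y)"
    using dominant_piece[of "\<lambda>x. cmod (f j x)" "e j" "1 / 10" y, OF f_in[OF j] _ y] by blast
qed

lemma functional_realized:
  assumes h: "h \<in> f ` I \<union> pairs"
  shows "\<exists>x r. 0 < r \<and> (\<forall>y. N (y - x) < r \<longrightarrow> N y = cmod (h y))"
proof -
  obtain w where w: "\<And>p. p \<in> pieces \<Longrightarrow> p \<noteq> (\<lambda>x. cmod (h x)) \<Longrightarrow> p w \<le> cmod (h w) - 1 / 2000"
    using exposure[OF h] by blast
  have "N y = cmod (h y)" if y: "N (y - w) < 1 / 4000" for y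
  proof -
    have "p w + 2 * (1 / 4000) \<le> cmod (h w)" if "p \<in> pieces" "p \<noteq> (\<lambda>x. cmod (h x))" for p
      using w[OF that] by simp
    then show ?thesis
      using dominant_piece[of "\<lambda>x. cmod (h x)" w "1 / 4000" y, OF functional_in[OF h] _ y] by blast
  qed
  then show ?thesis by (intro exI[of _ w] exI[of _ "1 / 4000"]) auto
qed

text \<open>
  Where a two-index functional equals \<open>N\<close>, the coordinate \<open>f j\<close> is within one percent of \<open>N\<close>, because
  \<open>\<bar>f k\<bar> \<le> N\<close> and the weight leaves hardly any slack. A step of a twentieth of the norm towards \<open>e j\<close>
  then makes \<open>f j\<close> exceed it.
\<close>

lemma pair_not_sharp:
  assumes z: "z \<in> {2, \<zeta>}" and jk: "j \<in> I" "k \<in> I" "lt j k"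
  shows "\<not> sharp (pair z j k)"
proof
  assume "sharp (pair z j k)"
  then obtain x where x0: "x \<noteq> 0" and eq: "\<And>y. N (y - x) < N x / 10 \<Longrightarrow> N y = cmod (pair z j k y)"
    unfolding sharp_def by blast
  note sb = scalar_bounds[OF z]
  note pf = pair_functional[OF z jk(1,2)] and fj = f_functional[OF jk(1)]
  define n where "n = N x"
  have n: "0 < n" using x0 N_zero_iff[of x] N_nonneg[of x] by (simp add: n_def)
  have "n = cmod (pair z j k x)" using eq[of x] n N_zero_iff[of 0] by (simp add: n_def)
  also have "\<dots> \<le> weight z * cmod (f j x + z * f k x) + n / 10000"
    using pair_upper[OF z jk(2), of j x] \<delta>_norm_le_N[of x] by (simp add: n_def)
  also have "weight z * cmod (f j x + z * f k x) \<le> weight z * (cmod (f j x) + cmod z * n)"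
    using weight_pos[of z] f_le_N[OF jk(2), of x]
    by (intro mult_left_mono order_trans[OF norm_triangle_ineq] add_mono)
      (auto simp: norm_mult n_def intro: mult_left_mono)
  finally have "9999 / 10000 * n \<le> weight z * (cmod (f j x) + cmod z * n)" by simp
  then have "(9999 / 10000 * n) * (1 + cmod z) \<le> (weight z * (cmod (f j x) + cmod z * n)) * (1 + cmod z)"
    by (intro mult_right_mono) auto
  also have "\<dots> = (weight z * (1 + cmod z)) * (cmod (f j x) + cmod z * n)" by (simp only: mult_ac)
  also have "\<dots> = 1001 / 1000 * (cmod (f j x) + cmod z * n)" by (simp only: sb(3))
  finally have "9999 / 10000 * n + 9999 / 10000 * (cmod z * n) \<le> 1001 / 1000 * cmod (f j x) + 1001 / 1000 * (cmod z * n)"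
    by (simp add: algebra_simps)
  moreover have "cmod z * n \<le> 3 * n" using sb(5) n by (intro mult_right_mono) auto
  ultimately have fjx: "99 / 100 * n \<le> cmod (f j x)" using n by linarith
  define t where "t = n / 20"
  have t: "0 < t" "t < n / 10" using n by (auto simp: t_def)
  obtain u where u: "cmod u = 1" "cmod (f j x + u * t) = cmod (f j x) + cmod t"
    using exists_aligning_phase[of "f j x" "of_real t"] by auto
  define y where "y = x + (u * of_real t) *\<^sub>C e j"
  have "cmod (f j y) = cmod (f j x) + t"
    using u(2) t jk by (simp add: y_def cfunctional_add[OF fj] cfunctional_scaleC[OF fj] biorthogonal)
  then have low: "cmod (f j x) + t \<le> N y" using f_le_N[OF jk(1), of y] by simp
  have "N (y - x) < N x / 10" using u(1) t by (simp add: y_def N_scaleC norm_mult N_e[OF jk(1)] n_def)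
  then have Ny: "N y = cmod (pair z j k y)" by (rule eq)
  have "j \<noteq> k" using jk lt_irrefl by auto
  then have "cmod (f j (e j) + z * f k (e j)) = 1" using jk by (simp add: biorthogonal)
  then have pe: "cmod (pair z j k (e j)) \<le> 1 / 2"
    using pair_upper[OF z jk(2), of j "e j"] \<delta>_norm_le[OF norm_e[OF jk(1)]] sb(1) by simp
  have "cmod (pair z j k y) \<le> cmod (pair z j k x) + t * cmod (pair z j k (e j))"
    using norm_triangle_ineq[of "pair z j k x" "u * of_real t * pair z j k (e j)"] u(1) t
    by (simp add: y_def cfunctional_add[OF pf] cfunctional_scaleC[OF pf] norm_mult)
  also have "\<dots> \<le> n + t * (1 / 2)"
    using functional_le_N[OF pair_in[OF z jk], of x] pe t
    by (intro add_mono mult_left_mono) (auto simp: n_def)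
  finally show False using low Ny fjx t n by (simp add: t_def)
qed

lemma is_complex_norm_N: "is_complex_norm N"
  using equivalent_complex_norm_N by (simp add: equivalent_complex_norm_def)

lemma isometryD:
  assumes "real_isometry N T"
  shows "linear T" "surj T" "N (T x) = N x"
proof -
  show lin: "linear T" "surj T" using assms by (auto simp: real_isometry_def)
  have "N (T x - T 0) = N (x - 0)" using assms unfolding real_isometry_def by blast
  then show "N (T x) = N x" by (simp add: linear_0[OF lin(1)])
qed

lemma N_ball_transport:
  assumes T: "real_isometry N T" and eq: "\<And>y. N (y - x) < r \<Longrightarrow> N y = cmod (h y)"
    and y: "N (y - inv T x) < r"
  shows "N y = cmod (h (T y))"
proof -
  note lin = isometryD(1)[OF T] and iso = isometryD(3)[OF T]
  have "N (T y - x) = N (T (y - inv T x))"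
    by (simp add: linear_diff[OF lin] real_isometry_inv(2)[OF T is_complex_norm_N])
  then have "N (T y - x) < r" using y by (simp add: iso)
  then show ?thesis using eq[of "T y"] by (simp add: iso)
qed

lemma sharp_transport:
  assumes T: "real_isometry N T" and h: "sharp h"
  shows "sharp (\<lambda>y. h (T y))"
proof -
  obtain x where x: "x \<noteq> 0" and eq: "\<And>y. N (y - x) < N x / 10 \<Longrightarrow> N y = cmod (h y)"
    using h unfolding sharp_def by blast
  have Nx: "N (inv T x) = N x"
    by (rule isometryD(3)[OF real_isometry_inv(1)[OF T is_complex_norm_N]])
  then have "inv T x \<noteq> 0" using x N_zero_iff by metis
  moreover have "N y = cmod (h (T y))" if "N (y - inv T x) < N (inv T x) / 10" for y
    using N_ball_transport[OF T eq, of x "N x / 10" y] that Nx by simp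
  ultimately show ?thesis unfolding sharp_def by blast
qed

lemma functional_transport:
  assumes T: "real_isometry N T" and h: "h \<in> f ` I \<union> pairs"
  shows "\<exists>h0 \<in> f ` I \<union> pairs. \<forall>y. cmod (h (T y)) = cmod (h0 y)"
proof -
  obtain x r where r: "0 < r" and eq: "\<And>y. N (y - x) < r \<Longrightarrow> N y = cmod (h y)"
    using functional_realized[OF h] by blast
  have lin: "linear (\<lambda>y. h (T y))"
    using linear_compose[OF isometryD(1)[OF T] cfunctional_linear[OF functional_bounded[OF h]]]
    by (simp add: o_def)
  show ?thesis
    by (rule N_local_modulus[OF lin r, of "inv T x"]) (rule N_ball_transport[OF T eq])
qed

lemma f_transport:
  assumes T: "real_isometry N T" and j: "j \<in> I"
  shows "\<exists>k\<in>I. \<forall>y. cmod (f j (T y)) = cmod (f k y)"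
proof -
  obtain h where h: "h \<in> f ` I \<union> pairs" "\<And>y. cmod (f j (T y)) = cmod (h y)"
    using functional_transport[OF T, of "f j"] j by blast
  from sharp_transport[OF T sharp_f[OF j]] have "sharp h"
    using sharp_cong[of "\<lambda>y. f j (T y)" h] h(2) by blast
  with h(1) show ?thesis
    by (cases rule: functional_cases) (use h(2) pair_not_sharp in auto)
qed

lemma pair_transport:
  assumes T: "real_isometry N T" and z: "z \<in> {2, \<zeta>}" and jk: "j \<in> I" "k \<in> I" "lt j k"
  shows "\<exists>z' l m. z' \<in> {2, \<zeta>} \<and> l \<in> I \<and> m \<in> I \<and> lt l m \<and>
    (\<forall>y. cmod (pair z j k (T y)) = cmod (pair z' l m y))"
proof -
  note inv = real_isometry_inv[OF T is_complex_norm_N]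
  obtain h where h: "h \<in> f ` I \<union> pairs" "\<And>y. cmod (pair z j k (T y)) = cmod (h y)"
    using functional_transport[OF T pair_in[OF z jk]] by blast
  from h(1) show ?thesis
  proof (cases rule: functional_cases)
    case (1 i)
    then have "sharp (\<lambda>y. pair z j k (T y))"
      using sharp_f[OF 1(1)] h(2) sharp_cong[of "\<lambda>y. pair z j k (T y)" h] by blast
    then have "sharp (pair z j k)"
      using sharp_transport[OF inv(1), of "\<lambda>y. pair z j k (T y)"] by (simp add: inv)
    then show ?thesis using pair_not_sharp[OF z jk] by blast
  next
    case (2 z' l m)
    then show ?thesis using h(2) by blast
  qed
qed

lemma pair_value:
  assumes z: "z \<in> {2, \<zeta>}" and k: "k \<in> I" and x: "N x = 1" "f j x = 0 \<or> f k x = 0"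
  shows "\<bar>cmod (pair z j k x) - weight z * (cmod (f j x) + cmod z * cmod (f k x))\<bar> \<le> 1 / 10000"
proof -
  have "cmod (f j x + z * f k x) = cmod (f j x) + cmod z * cmod (f k x)"
    using x(2) by (auto simp: norm_mult)
  moreover have "\<delta> * norm x \<le> 1 / 10000" using \<delta>_norm_le_N[of x] x(1) by simp
  ultimately show ?thesis
    using pair_upper[OF z k, of j x] pair_lower[OF z k, of j x] by (simp only: abs_le_iff) linarith
qed

text \<open>
  Up to \<open>1 / 10000\<close>, the modulus of a two-index functional at the vectors \<open>e i\<close> is \<open>weight z\<close> at the first
  index, \<open>weight z * cmod z\<close> at the second and zero elsewhere. The same holds for its composition with
  \<open>T\<close>, at the transported indices. These numbers determine the coefficient and the order of the indices.
\<close>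

lemma pair_transport_index:
  assumes T: "real_isometry N T" and z: "z \<in> {2, \<zeta>}" and jk: "j \<in> I" "k \<in> I" "lt j k"
    and j': "j' \<in> I" "\<And>y. cmod (f j (T y)) = cmod (f j' y)"
    and k': "k' \<in> I" "\<And>y. cmod (f k (T y)) = cmod (f k' y)"
  shows "lt j' k'" "cmod (pair z j k (T y)) = cmod (pair z j' k' y)"
proof -
  obtain z' l m where z': "z' \<in> {2, \<zeta>}" and lm: "l \<in> I" "m \<in> I" "lt l m"
    and eq: "\<And>y. cmod (pair z j k (T y)) = cmod (pair z' l m y)"
    using pair_transport[OF T z jk] by blast
  have lnm: "l \<noteq> m" using lm lt_irrefl by auto
  have jnk: "j \<noteq> k" using jk lt_irrefl by auto
  have "f j (T (inv T (e j))) = 1" "f k (T (inv T (e j))) = 0"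
    using jk jnk by (simp_all add: real_isometry_inv(2)[OF T is_complex_norm_N] biorthogonal)
  then have jk': "j' \<noteq> k'"
    using j'(2)[of "inv T (e j)"] k'(2)[of "inv T (e j)"] by force
  have fT: "cmod (f j (T (e i))) = (if i = j' then 1 else 0)"
    "cmod (f k (T (e i))) = (if i = k' then 1 else 0)" if "i \<in> I" for i
    using j' k' that by (auto simp: biorthogonal)
  define p where "p i = cmod (pair z j k (T (e i)))" for i
  have vT: "\<bar>p i - weight z * ((if i = j' then 1 else 0) + cmod z * (if i = k' then 1 else 0))\<bar> \<le> 1 / 10000"
    if i: "i \<in> I" for i
  proof -
    have "cmod (f j (T (e i))) = 0 \<or> cmod (f k (T (e i))) = 0"
      using fT[OF i] jk' by auto
    then have "f j (T (e i)) = 0 \<or> f k (T (e i)) = 0" by simp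
    moreover have "N (T (e i)) = 1" using N_e[OF i] isometryD(3)[OF T] by simp
    ultimately show ?thesis using pair_value[OF z jk(2), of "T (e i)" j] fT[OF i] by (simp only: p_def)
  qed
  have v: "\<bar>p i - weight z' * ((if i = l then 1 else 0) + cmod z' * (if i = m then 1 else 0))\<bar> \<le> 1 / 10000"
    if i: "i \<in> I" for i
    using pair_value[OF z' lm(2), of "e i" l] lnm lm i N_e[OF i]
    by (auto simp: biorthogonal p_def eq eq_commute[of i])
  have vals: "1 / 4 \<le> weight w" "weight w \<le> 34 / 100" "6 / 10 \<le> weight w * cmod w" if "w \<in> {2, \<zeta>}" for w
    using that by (auto simp: weight_2 weight_\<zeta> norm_\<zeta>)
  have pj: "\<bar>p j' - weight z\<bar> \<le> 1 / 10000" and pk: "\<bar>p k' - weight z * cmod z\<bar> \<le> 1 / 10000"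
    using vT[OF j'(1)] vT[OF k'(1)] jk' by auto
  have pl: "\<bar>p l - weight z'\<bar> \<le> 1 / 10000" and pm: "\<bar>p m - weight z' * cmod z'\<bar> \<le> 1 / 10000"
    using v[OF lm(1)] v[OF lm(2)] lnm by auto
  have small: "p i \<le> 1 / 10000" if "i \<in> I" "i \<noteq> j'" "i \<noteq> k'" for i
    using vT[OF that(1)] that by simp
  have "m \<noteq> j'"
  proof
    assume "m = j'"
    then show False using pm pj vals(2)[OF z] vals(3)[OF z'] by (simp only: abs_le_iff) linarith
  qed
  moreover have "m = j' \<or> m = k'" using small[OF lm(2)] pm vals(3)[OF z'] by force
  ultimately have m: "m = k'" by blast
  have "l = j' \<or> l = k'" using small[OF lm(1)] pl vals(1)[OF z'] by force
  then have l: "l = j'" using m lnm by blast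
  have "\<bar>weight z - weight z'\<bar> \<le> 2 / 10000" using pl pj unfolding l abs_le_iff by linarith
  then have "z' = z" using z z' by (auto simp: weight_2 weight_\<zeta>)
  then show "lt j' k'" "cmod (pair z j k (T y)) = cmod (pair z j' k' y)"
    using l m lm eq by auto
qed

lemma order_preserving_not_below:
  assumes \<tau>: "\<And>j. j \<in> I \<Longrightarrow> \<tau> j \<in> I" and mono: "\<And>j k. j \<in> I \<Longrightarrow> k \<in> I \<Longrightarrow> lt j k \<Longrightarrow> lt (\<tau> j) (\<tau> k)"
    and j: "j \<in> I"
  shows "\<not> lt (\<tau> j) j"
proof
  assume "lt (\<tau> j) j"
  then obtain m where m: "m \<in> I" "lt (\<tau> m) m" and least: "\<And>i. i \<in> I \<Longrightarrow> lt (\<tau> i) i \<Longrightarrow> \<not> lt i m"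
    using lt_minimal[of "{i\<in>I. lt (\<tau> i) i}"] j by auto
  have "lt (\<tau> (\<tau> m)) (\<tau> m)" using mono[OF \<tau>[OF m(1)] m(1) m(2)] .
  then show False using least[OF \<tau>[OF m(1)]] m by blast
qed

lemma f_transport_index:
  assumes T: "real_isometry N T"
  obtains \<tau> where "\<And>j. j \<in> I \<Longrightarrow> \<tau> j \<in> I" "\<And>j y. j \<in> I \<Longrightarrow> cmod (f j (T y)) = cmod (f (\<tau> j) y)"
    "\<And>j k. j \<in> I \<Longrightarrow> k \<in> I \<Longrightarrow> lt j k \<Longrightarrow> lt (\<tau> j) (\<tau> k)"
proof -
  have "\<forall>j\<in>I. \<exists>k. k \<in> I \<and> (\<forall>y. cmod (f j (T y)) = cmod (f k y))"
    using f_transport[OF T] by blast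
  then obtain \<tau> where \<tau>: "\<And>j. j \<in> I \<Longrightarrow> \<tau> j \<in> I"
    "\<And>j y. j \<in> I \<Longrightarrow> cmod (f j (T y)) = cmod (f (\<tau> j) y)"
    by (metis bchoice)
  have "lt (\<tau> j) (\<tau> k)" if jk: "j \<in> I" "k \<in> I" "lt j k" for j k
    by (rule pair_transport_index(1)[OF T _ jk \<tau>(1)[OF jk(1)] \<tau>(2)[OF jk(1)] \<tau>(1)[OF jk(2)]
          \<tau>(2)[OF jk(2)], of 2]) simp
  with \<tau> show ?thesis by (rule that)
qed

lemma f_transport_same:
  assumes T: "real_isometry N T" and j: "j \<in> I"
  shows "cmod (f j (T y)) = cmod (f j y)"
proof -
  note inv = real_isometry_inv[OF T is_complex_norm_N]
  obtain \<tau> where \<tau>: "\<And>j. j \<in> I \<Longrightarrow> \<tau> j \<in> I" "\<And>j y. j \<in> I \<Longrightarrow> cmod (f j (T y)) = cmod (f (\<tau> j) y)"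
    "\<And>j k. j \<in> I \<Longrightarrow> k \<in> I \<Longrightarrow> lt j k \<Longrightarrow> lt (\<tau> j) (\<tau> k)"
    using f_transport_index[OF T] by blast
  obtain \<sigma> where \<sigma>: "\<And>j. j \<in> I \<Longrightarrow> \<sigma> j \<in> I"
    "\<And>j y. j \<in> I \<Longrightarrow> cmod (f j (inv T y)) = cmod (f (\<sigma> j) y)"
    "\<And>j k. j \<in> I \<Longrightarrow> k \<in> I \<Longrightarrow> lt j k \<Longrightarrow> lt (\<sigma> j) (\<sigma> k)"
    using f_transport_index[OF inv(1)] by blast
  have "cmod (f j (e j)) = cmod (f (\<sigma> (\<tau> j)) (e j))"
    using \<tau>(2)[OF j, of "inv T (e j)"] \<sigma>(2)[OF \<tau>(1)[OF j], of "e j"] by (simp add: inv)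
  then have undo: "\<sigma> (\<tau> j) = j"
    using j \<sigma>(1)[OF \<tau>(1)[OF j]] by (simp add: biorthogonal split: if_splits)
  have "\<not> lt (\<tau> j) j" using order_preserving_not_below[of \<tau>, OF \<tau>(1,3) j] .
  moreover have "\<not> lt j (\<tau> j)"
    using order_preserving_not_below[of \<sigma>, OF \<sigma>(1,3) \<tau>(1)[OF j]] undo by simp
  ultimately have "\<tau> j = j" using lt_total[OF \<tau>(1)[OF j] j] by blast
  then show ?thesis using \<tau>(2)[OF j] by simp
qed

lemma pair_transport_same:
  assumes T: "real_isometry N T" and z: "z \<in> {2, \<zeta>}" and jk: "j \<in> I" "k \<in> I" "lt j k"
  shows "cmod (pair z j k (T y)) = cmod (pair z j k y)"
  by (rule pair_transport_index(2)[OF T z jk jk(1) f_transport_same[OF T jk(1)] jk(2)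
        f_transport_same[OF T jk(2)]])

lemma pair_phase:
  assumes T: "real_isometry N T" and z: "z \<in> {2, \<zeta>}" and jk: "j \<in> I" "k \<in> I" "lt j k"
  shows "\<exists>u c. cmod u = 1 \<and> (c = (\<lambda>z. z) \<or> c = cnj) \<and>
    (\<forall>y. f j (T y) + z * f k (T y) + of_real \<delta> * g k (T y) = u * c (f j y + z * f k y + of_real \<delta> * g k y))"
proof -
  note pf = pair_functional[OF z jk(1,2)]
  have "linear (\<lambda>y. pair z j k (T y))"
    using linear_compose[OF isometryD(1)[OF T] cfunctional_linear[OF pf]] by (simp add: o_def)
  then obtain u c where u: "cmod u = 1" and c: "c = (\<lambda>z. z) \<or> c = cnj"
    and eq: "\<And>y. pair z j k (T y) = u * c (pair z j k y)"
    using modulus_eq_imp_unimodular_multiple[OF _ pf] pair_transport_same[OF T z jk] by blast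
  have "f j (T y) + z * f k (T y) + of_real \<delta> * g k (T y) = u * c (f j y + z * f k y + of_real \<delta> * g k y)" for y
  proof -
    have "c (of_real (weight z) * x) = of_real (weight z) * c x" for x using c by auto
    then have "of_real (weight z) * (f j (T y) + z * f k (T y) + of_real \<delta> * g k (T y))
        = of_real (weight z) * (u * c (f j y + z * f k y + of_real \<delta> * g k y))"
      using eq[of y] by (simp add: pair_def)
    then show ?thesis using weight_pos[of z] by simp
  qed
  then show ?thesis using u c by blast
qed

text \<open>
  Write \<open>l i\<close> and \<open>c i\<close> for the phase and the conjugation type of \<open>T\<close> on \<open>f i\<close>. Since \<open>f j + 2 f k + \<delta> g k\<close> and
  \<open>f j + \<zeta> f k + \<delta> g k\<close> agree on the multiples of \<open>e j\<close> and do not vanish there, \<open>T\<close> acts on both with the same phase and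
  type; their difference is a multiple of \<open>f k\<close>, so this phase \<open>v k\<close> depends on \<open>k\<close> only. For \<open>k = b\<close> the
  term \<open>g k\<close> is absent and the phases of \<open>a\<close> and \<open>b\<close> agree, which also forces \<open>c \<zeta> = \<zeta>\<close>. For any later
  \<open>k\<close>, comparing \<open>j = a\<close> with \<open>j = b\<close> eliminates \<open>g k\<close> and yields the same phase for \<open>k\<close>, and then for \<open>g k\<close>.
\<close>

theorem isometry_acts_by_phase:
  assumes T: "real_isometry N T"
  shows "\<exists>u c. cmod u = 1 \<and> (c = (\<lambda>z. z) \<or> c = cnj) \<and> c \<zeta> = \<zeta> \<and>
    (\<forall>i\<in>I. \<forall>y. f i (T y) = u * c (f i y) \<and> g i (T y) = u * c (g i y))"
proof -
  let ?C = "{\<lambda>z. z, cnj}"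
  have "\<exists>l c. cmod l = 1 \<and> c \<in> ?C \<and> (\<forall>y. f i (T y) = l * c (f i y))" if i: "i \<in> I" for i
  proof -
    have "linear (\<lambda>y. f i (T y))"
      using linear_compose[OF isometryD(1)[OF T] cfunctional_linear[OF f_functional[OF i]]]
      by (simp add: o_def)
    from modulus_eq_imp_unimodular_multiple[OF this f_functional[OF i] f_transport_same[OF T i]]
    show ?thesis by blast
  qed
  then obtain l c where l: "\<And>i. i \<in> I \<Longrightarrow> cmod (l i) = 1" and c: "\<And>i. i \<in> I \<Longrightarrow> c i \<in> ?C"
    and fT: "\<And>i y. i \<in> I \<Longrightarrow> f i (T y) = l i * c i (f i y)"
    by metis
  have l0: "l i \<noteq> 0" if "i \<in> I" for i using l[OF that] by auto
  have hom: "d (x + y) = d x + d y" "d (x - y) = d x - d y" "d (x * y) = d x * d y" "d 0 = 0" "d 1 = 1"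
    "d (of_real r) = of_real r" "d 2 = 2" "d (d x) = x"
    if "d \<in> ?C" for d x y r using that by auto
  have zero_iff: "d x = 0 \<longleftrightarrow> x = 0" if "d \<in> ?C" for d x using that by auto
  have uniq: "d = d' \<and> \<alpha> = \<beta>"
    if "d \<in> ?C" "d' \<in> ?C" "\<alpha> \<noteq> 0" "\<And>x. \<alpha> * d x = \<beta> * d' x" for d d' \<alpha> \<beta>
    using unimodular_multiple_unique[of d d' \<alpha> \<beta>] that by blast
  have scale: "f i (x *\<^sub>C e j) = (if i = j then x else 0)" if "i \<in> I" "j \<in> I" for i j x
    using that by (simp add: cfunctional_scaleC[OF f_functional] biorthogonal)
  have two_\<zeta>: "2 - \<zeta> \<noteq> 0" using norm_\<zeta> by auto
  define v where "v k = (2 - \<zeta>) * l k / c k (2 - \<zeta>)" for k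
  have v_eq: "(2 - \<zeta>) * l k = v k * c k (2 - \<zeta>)" if k: "k \<in> I" for k
  proof -
    have "c k (2 - \<zeta>) \<noteq> 0" using zero_iff[OF c[OF k]] two_\<zeta> by blast
    then show ?thesis by (simp add: v_def)
  qed
  have main: "l j * c j (f j y) + 2 * (l k * c k (f k y)) + of_real \<delta> * g k (T y)
      = v k * c k (f j y + 2 * f k y + of_real \<delta> * g k y)"
    if jk: "j \<in> I" "k \<in> I" "lt j k" for j k y
  proof -
    have jnk: "j \<noteq> k" using jk lt_irrefl by auto
    obtain u1 d1 where d1: "d1 \<in> ?C" and u1: "cmod u1 = 1"
      and e1: "\<And>y. f j (T y) + 2 * f k (T y) + of_real \<delta> * g k (T y) = u1 * d1 (f j y + 2 * f k y + of_real \<delta> * g k y)"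
      using pair_phase[OF T _ jk, of 2] by blast
    obtain u2 d2 where d2: "d2 \<in> ?C"
      and e2: "\<And>y. f j (T y) + \<zeta> * f k (T y) + of_real \<delta> * g k (T y) = u2 * d2 (f j y + \<zeta> * f k y + of_real \<delta> * g k y)"
      using pair_phase[OF T _ jk, of \<zeta>] by blast
    have diff: "(2 - \<zeta>) * f k (T y) = u1 * d1 (f j y + 2 * f k y + of_real \<delta> * g k y)
        - u2 * d2 (f j y + \<zeta> * f k y + of_real \<delta> * g k y)" for y
      unfolding e1[symmetric] e2[symmetric] by (simp add: algebra_simps)
    \<comment> \<open>Both two-index functionals take the nonzero value \<open>\<gamma>\<close> at \<open>e j\<close>, as \<open>\<delta>\<close> is small.\<close>
    define \<gamma> where "\<gamma> = 1 + of_real \<delta> * g k (e j)"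
    have "cmod (of_real \<delta> * g k (e j)) \<le> 1 / 100000 * (1 * 1)"
      using \<delta>_pos \<delta>_le order_trans[OF cfunctional_bound[OF g_functional[OF jk(2)]], of "e j" 1] norm_e[OF jk(1)]
      by (simp only: norm_mult norm_of_real) (intro mult_mono, auto)
    then have "of_real \<delta> * g k (e j) \<noteq> -1" by auto
    then have \<gamma>: "\<gamma> \<noteq> 0" unfolding \<gamma>_def by (metis add_eq_0_iff)
    have "u1 * d1 x = u2 * d2 x" for x
    proof -
      define q where "q = x / \<gamma>"
      have q: "q * \<gamma> = x" using \<gamma> by (simp add: q_def)
      have "f k (T (q *\<^sub>C e j)) = 0"
        using jk jnk hom(4)[OF c[OF jk(2)]] by (simp add: fT scale)
      moreover have "f j (q *\<^sub>C e j) + w * f k (q *\<^sub>C e j) + of_real \<delta> * g k (q *\<^sub>C e j) = x" for w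
        using jk jnk
        by (simp add: scale cfunctional_scaleC[OF g_functional] \<gamma>_def algebra_simps flip: q)
      ultimately show ?thesis using diff[of "q *\<^sub>C e j"] by simp
    qed
    moreover have "u1 \<noteq> 0" using u1 by auto
    ultimately have d12: "d2 = d1" "u2 = u1" using uniq[OF d1 d2] by auto
    have diff': "(2 - \<zeta>) * (l k * c k (f k y)) = u1 * d1 (2 - \<zeta>) * d1 (f k y)" for y
    proof -
      have "(2 - \<zeta>) * (l k * c k (f k y)) = u1 * (d1 (f j y + 2 * f k y + of_real \<delta> * g k y)
        - d1 (f j y + \<zeta> * f k y + of_real \<delta> * g k y))"
        using diff[of y] fT[OF jk(2)] by (simp add: d12 algebra_simps)
      also have "\<dots> = u1 * d1 ((2 - \<zeta>) * f k y)"
        unfolding hom(2)[OF d1, symmetric] by (simp add: algebra_simps)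
      finally show ?thesis by (simp add: hom(3)[OF d1])
    qed
    have "(2 - \<zeta>) * l k * c k x = (u1 * d1 (2 - \<zeta>)) * d1 x" for x
      using diff'[of "x *\<^sub>C e k"] jk by (simp add: scale mult.assoc)
    from uniq[OF c[OF jk(2)] d1 _ this] have "c k = d1" "(2 - \<zeta>) * l k = u1 * d1 (2 - \<zeta>)"
      using two_\<zeta> l0[OF jk(2)] by auto
    moreover from this have "u1 = v k"
      using two_\<zeta> v_eq[OF jk(2)] zero_iff[OF d1] by simp
    ultimately show ?thesis using e1[of y] fT[OF jk(1)] fT[OF jk(2)] by simp
  qed
  \<comment> \<open>The first two indices, where no \<open>g\<close> interferes.\<close>
  have "l b * c b x = v b * c b x" for x
    using main[OF a_in b_in a_lt_b, of "x *\<^sub>C e b"] a_in b_in ab hom[OF c[OF a_in]] hom[OF c[OF b_in]]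
    by (simp add: scale g_b)
  then have lb: "l b = v b" using uniq[OF c[OF b_in] c[OF b_in] l0[OF b_in]] by blast
  have "l a * c a x = v b * c b x" for x
    using main[OF a_in b_in a_lt_b, of "x *\<^sub>C e a"] a_in b_in ab hom[OF c[OF a_in]] hom[OF c[OF b_in]]
    by (simp add: scale g_b)
  then have ab_eq: "c a = c b" "l a = l b"
    using uniq[OF c[OF a_in] c[OF b_in] l0[OF a_in]] lb by auto
  have "c b (2 - \<zeta>) = 2 - \<zeta>" using v_eq[OF b_in] lb l0[OF b_in] by simp
  then have c\<zeta>: "c b \<zeta> = \<zeta>" by (simp add: hom[OF c[OF b_in]])
  have rest: "c k = c b \<and> l k = l b \<and> (\<forall>y. g k (T y) = l b * c b (g k y))"
    if k: "k \<in> I" for k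
  proof -
    consider "k = a" | "k = b" | "k \<noteq> a" "k \<noteq> b" by blast
    then show ?thesis
    proof cases
      case 1
      then show ?thesis using ab_eq hom(4)[OF c[OF b_in]] by (simp add: g_a)
    next
      case 2
      then show ?thesis using hom(4)[OF c[OF b_in]] by (simp add: g_b)
    next
      case 3
      have ak: "lt a k" and bk: "lt b k" using a_first b_second k 3 by auto
      have "l b * c b x = v k * c k x" for x
        using main[OF a_in k ak, of "x *\<^sub>C e a"] main[OF b_in k bk, of "x *\<^sub>C e a"] k 3 a_in b_in ab
          hom[OF c[OF k]] hom[OF c[OF b_in]]
        by (auto simp add: scale ab_eq algebra_simps)
      from uniq[OF c[OF b_in] c[OF k] l0[OF b_in] this] have ck: "c k = c b" "v k = l b" by auto
      have "(2 - \<zeta>) * l k = l b * c b (2 - \<zeta>)" using v_eq[OF k] ck by simp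
      then have lk: "l k = l b" using two_\<zeta> by (simp add: hom[OF c[OF b_in]] c\<zeta>)
      have "of_real \<delta> * g k (T y) = of_real \<delta> * (l b * c b (g k y))" for y
        using main[OF a_in k ak, of y] by (simp add: ck lk ab_eq hom[OF c[OF b_in]] algebra_simps)
      then have "g k (T y) = l b * c b (g k y)" for y using \<delta>_pos by simp
      then show ?thesis using ck lk by blast
    qed
  qed
  have "f i (T y) = l b * c b (f i y) \<and> g i (T y) = l b * c b (g i y)" if "i \<in> I" for i y
    using rest[OF that] fT[OF that] by simp
  moreover have "c b = (\<lambda>z. z) \<or> c b = cnj" using c[OF b_in] by blast
  ultimately show ?thesis using l[OF b_in] c\<zeta> by blast
qed

lemma N_conjugation_invariant:
  assumes C: "\<And>x. norm (C x) = norm x" and \<zeta>: "cnj \<zeta> = \<zeta>"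
    and f: "\<And>i x. i \<in> I \<Longrightarrow> f i (C x) = cnj (f i x)" and g: "\<And>i x. i \<in> I \<Longrightarrow> g i (C x) = cnj (g i x)"
  shows "N (C x) = N x"
proof -
  have "p (C x) = p x" if "p \<in> pieces" for p
    using that
  proof (cases rule: pieces_cases)
    case 1
    then show ?thesis using C f a_in b_in by (simp add: base_def)
  next
    case (2 h)
    from 2(1) have "h (C x) = cnj (h x)"
    proof (cases rule: functional_cases)
      case (1 j)
      then show ?thesis using f by simp
    next
      case (2 z j k)
      then have "cnj z = z" using \<zeta> by auto
      then show ?thesis using 2 f g by (simp add: pair_def)
    qed
    then show ?thesis using 2(2) by simp
  qed
  then show ?thesis unfolding N_def by (intro SUP_cong) auto
qed

end

section \<open>Existence of rigid systems, with and without a conjugation\<close>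

lemma exists_first_two_order:
  fixes I :: "'i set"
  assumes "i \<in> I" "j \<in> I" "i \<noteq> j"
  shows "\<exists>lt a b. (\<forall>i\<in>I. \<forall>j\<in>I. i \<noteq> j \<longrightarrow> lt i j \<or> lt j i) \<and>
    (\<forall>A\<subseteq>I. A \<noteq> {} \<longrightarrow> (\<exists>m\<in>A. \<forall>i\<in>A. \<not> lt i m)) \<and> (\<forall>i j. lt i j \<longrightarrow> \<not> lt j i) \<and>
    a \<in> I \<and> b \<in> I \<and> a \<noteq> b \<and> (\<forall>i\<in>I. i \<noteq> a \<longrightarrow> lt a i) \<and> (\<forall>i\<in>I. i \<noteq> a \<longrightarrow> i \<noteq> b \<longrightarrow> lt b i)"
proof -
  obtain r where r: "well_order_on (UNIV :: 'i set) r" using well_order_on by blast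
  define lt where "lt x y \<longleftrightarrow> (x, y) \<in> r - Id" for x y
  have wf: "wf (r - Id)" and lin: "linear_order_on UNIV r" using r by (auto simp: well_order_on_def)
  have tot: "lt x y \<or> lt y x" if "x \<noteq> y" for x y
    using lin that by (auto simp: lt_def linear_order_on_def total_on_def)
  have asym: "\<not> lt y x" if "lt x y" for x y
    using wf_not_sym[OF wf] that by (simp add: lt_def)
  have min: "\<exists>m\<in>A. \<forall>i\<in>A. \<not> lt i m" if "A \<noteq> {}" for A
    using wf that unfolding lt_def wf_eq_minimal by (metis all_not_in_conv)
  obtain a where a: "a \<in> I" "\<And>i. i \<in> I \<Longrightarrow> \<not> lt i a" using min[of I] assms(1) by blast
  obtain b where b: "b \<in> I" "b \<noteq> a" "\<And>i. i \<in> I \<Longrightarrow> i \<noteq> a \<Longrightarrow> \<not> lt i b"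
    using min[of "I - {a}"] assms by blast
  have "\<forall>i\<in>I. \<forall>j\<in>I. i \<noteq> j \<longrightarrow> lt i j \<or> lt j i" using tot by blast
  moreover have "\<forall>A\<subseteq>I. A \<noteq> {} \<longrightarrow> (\<exists>m\<in>A. \<forall>i\<in>A. \<not> lt i m)" using min by blast
  moreover have "\<forall>i j. lt i j \<longrightarrow> \<not> lt j i" using asym by blast
  moreover have "\<forall>i\<in>I. i \<noteq> a \<longrightarrow> lt a i" using tot a(2) by blast
  moreover have "\<forall>i\<in>I. i \<noteq> a \<longrightarrow> i \<noteq> b \<longrightarrow> lt b i" using tot b(3) by blast
  ultimately show ?thesis using a(1) b(1,2) by blast
qed

context dual_setting
begin

text \<open>
  The single functional of the second alternative suffices when the biorthogonal system has at most
  one vector, so that there are no two indices to compare.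
\<close>

theorem exists_rigid_system_or_line:
  assumes \<zeta>: "cmod \<zeta> = 3" "Re \<zeta> \<le> 0"
  shows "(\<exists>I f g lt a b K. rigid_system I (\<lambda>i. i) f g lt a b K \<zeta> \<and> (\<forall>i\<in>I. f i \<in> D \<and> g i \<in> D) \<and>
      total (f ` I \<union> g ` I)) \<or> (\<exists>f\<in>D. total {f})"
proof -
  obtain I f K where sys: "biorthogonal_system I f K" and fin: "finite I \<Longrightarrow> total (f ` I)"
    and inf: "\<And>A. infinite I \<Longrightarrow> finite A \<Longrightarrow> \<exists>g. completion I f A g"
    using exists_biorthogonal_system by blast
  show ?thesis
  proof (cases "\<exists>i\<in>I. \<exists>j\<in>I. i \<noteq> j")
    case True
    then obtain i j where ij: "i \<in> I" "j \<in> I" "i \<noteq> j" by blast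
    obtain lt a b where ord: "\<forall>i\<in>I. \<forall>j\<in>I. i \<noteq> j \<longrightarrow> lt i j \<or> lt j i"
      "\<forall>A\<subseteq>I. A \<noteq> {} \<longrightarrow> (\<exists>m\<in>A. \<forall>i\<in>A. \<not> lt i m)" "\<forall>i j. lt i j \<longrightarrow> \<not> lt j i"
      "a \<in> I" "b \<in> I" "a \<noteq> b" "\<forall>i\<in>I. i \<noteq> a \<longrightarrow> lt a i" "\<forall>i\<in>I. i \<noteq> a \<longrightarrow> i \<noteq> b \<longrightarrow> lt b i"
      using exists_first_two_order[OF ij] by (elim exE conjE) (rule that)
    have "\<exists>g. completion I f {a, b} g"
    proof (cases "finite I")
      case True
      have "total (f ` I \<union> (\<lambda>_ _. 0) ` I)" using fin[OF True] unfolding total_def by blast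
      then have "completion I f {a, b} (\<lambda>_ _. 0)" by (simp add: completion_def D_zero cfunctional_zero)
      then show ?thesis by blast
    next
      case False
      then show ?thesis by (rule inf) simp
    qed
    then obtain g where "completion I f {a, b} g" by blast
    then have g: "\<And>i. i \<in> I \<Longrightarrow> g i \<in> D" "\<And>i. i \<in> I \<Longrightarrow> cfunctional 1 (g i)"
      "\<forall>i\<in>{a, b}. g i = (\<lambda>_. 0)" "total (f ` I \<union> g ` I)"
      by (simp_all add: completion_def)
    have "rigid_system I (\<lambda>i. i) f g lt a b K \<zeta>"
    proof
      fix i j assume "i \<in> I" "j \<in> I"
      then show "f i j = (if i = j then 1 else 0)"
        using sys unfolding biorthogonal_system_def by blast
    next
      fix i assume "i \<in> I"
      then show "cfunctional K (f i)" "norm i \<le> 1"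
        using sys unfolding biorthogonal_system_def by auto
    next
      show "0 \<le> K" using sys unfolding biorthogonal_system_def by blast
    next
      fix i j assume "i \<in> I" "j \<in> I" "i \<noteq> j"
      then show "lt i j \<or> lt j i" using ord(1) by simp
    next
      fix A assume "A \<subseteq> I" "A \<noteq> {}"
      then show "\<exists>m\<in>A. \<forall>i\<in>A. \<not> lt i m" using ord(2) by simp
    next
      fix i j assume "lt i j"
      then show "\<not> lt j i" using ord(3) by simp
    next
      show "a \<in> I" "b \<in> I" "a \<noteq> b" by (fact ord)+
    next
      fix i assume "i \<in> I" "i \<noteq> a"
      then show "lt a i" using ord(7) by simp
    next
      fix i assume "i \<in> I" "i \<noteq> a" "i \<noteq> b"
      then show "lt b i" using ord(8) by simp
    next
      show "g a = (\<lambda>_. 0)" "g b = (\<lambda>_. 0)" using g(3) by simp_all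
    next
      fix i assume "i \<in> I"
      then show "cfunctional 1 (g i)" by (rule g(2))
    qed (fact \<zeta>)+
    moreover have "\<forall>i\<in>I. f i \<in> D \<and> g i \<in> D"
      using sys g(1) unfolding biorthogonal_system_def by blast
    ultimately show ?thesis using g(4) by blast
  next
    case False
    then consider "I = {}" | i where "I = {i}" by blast
    then show ?thesis
    proof cases
      case 1
      then have "total {\<lambda>_. 0}" using fin unfolding total_def by auto
      then show ?thesis using D_zero by blast
    next
      case (2 i)
      then have "total {f i}" "f i \<in> D" using fin sys unfolding biorthogonal_system_def by auto
      then show ?thesis by blast
    qed
  qed
qed

end

text \<open>
  The map \<open>\<rho>\<close> is the identity in the complex case, and the real part with respect to a conjugation in
  the other; \<open>\<kappa>\<close> is what it does to coefficients.
\<close>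

lemma qspan_approximates_span:
  fixes S :: "'a::complex_normed_vector set" and \<rho> :: "'a \<Rightarrow> 'a"
  assumes \<rho>0: "\<rho> 0 = 0" and \<rho>: "\<And>c s y. s \<in> S \<Longrightarrow> \<rho> (c *\<^sub>C s + y) = \<kappa> c *\<^sub>C s + \<rho> y"
    and dense: "\<And>c \<epsilon>. 0 < \<epsilon> \<Longrightarrow> \<exists>q\<in>Q. cmod (\<kappa> c - q) < \<epsilon>"
    and y: "y \<in> complex_vector.span S" and \<epsilon>: "0 < \<epsilon>"
  shows "\<exists>y0\<in>qspan Q S. norm (\<rho> y - y0) < \<epsilon>"
  using y \<epsilon>
proof (induction arbitrary: \<epsilon> rule: complex_vector.span_induct_alt)
  case base
  then show ?case using \<rho>0 by (intro bexI[of _ 0]) (auto intro: qspan.zero)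
next
  case (step c s y)
  obtain y0 where y0: "y0 \<in> qspan Q S" "norm (\<rho> y - y0) < \<epsilon> / 2"
    using step.IH[of "\<epsilon> / 2"] step.prems by auto
  have "0 < \<epsilon> / (2 * (norm s + 1))" using step.prems by (intro divide_pos_pos) (auto intro: add_nonneg_pos)
  then obtain q where q: "q \<in> Q" "cmod (\<kappa> c - q) < \<epsilon> / (2 * (norm s + 1))" using dense by blast
  have "cmod (\<kappa> c - q) * norm s \<le> \<epsilon> / (2 * (norm s + 1)) * norm s"
    using q(2) by (intro mult_right_mono) auto
  also have "\<dots> \<le> \<epsilon> / 2"
    using step.prems add_nonneg_pos[OF norm_ge_zero[of s] zero_less_one] by (simp add: field_simps)
  finally have small: "norm ((\<kappa> c - q) *\<^sub>C s) \<le> \<epsilon> / 2" by (simp add: norm_scaleC)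
  have eq: "\<rho> (c *\<^sub>C s + y) - (y0 + q *\<^sub>C s) = (\<kappa> c - q) *\<^sub>C s + (\<rho> y - y0)"
    by (simp add: \<rho>[OF step.hyps(1)] complex_vector.scale_left_diff_distrib)
  have "norm (\<rho> (c *\<^sub>C s + y) - (y0 + q *\<^sub>C s)) < \<epsilon>"
    unfolding eq using norm_triangle_ineq[of "(\<kappa> c - q) *\<^sub>C s" "\<rho> y - y0"] small y0(2) by linarith
  then show ?case using qspan.step[OF y0(1) q(1) step.hyps(1)] by blast
qed

lemma rational_approximation: "0 < \<epsilon> \<Longrightarrow> \<exists>r\<in>\<rat>. \<bar>x - r\<bar> < (\<epsilon> :: real)"
proof -
  assume "0 < \<epsilon>"
  then obtain r where "r \<in> \<rat>" "x < r" "r < x + \<epsilon>" using Rats_dense_in_real[of x "x + \<epsilon>"] by auto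
  then show ?thesis by (intro bexI[of _ r]) auto
qed

definition Gauss_rationals :: "complex set"
  where "Gauss_rationals = (\<lambda>(r, s). Complex r s) ` (\<rat> \<times> \<rat>)"

lemma Gauss_rationals_dense:
  assumes "0 < \<epsilon>" shows "\<exists>q\<in>Gauss_rationals. cmod (c - q) < \<epsilon>"
proof -
  obtain r s where rs: "r \<in> \<rat>" "\<bar>Re c - r\<bar> < \<epsilon> / 2" "s \<in> \<rat>" "\<bar>Im c - s\<bar> < \<epsilon> / 2"
    using rational_approximation[of "\<epsilon> / 2"] assms by (meson half_gt_zero)
  then have "cmod (c - Complex r s) < \<epsilon>" using cmod_le[of "c - Complex r s"] by simp
  then show ?thesis using rs by (intro bexI[of _ "Complex r s"]) (auto simp: Gauss_rationals_def)
qed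

interpretation all_vectors: dual_setting "UNIV :: 'a::complex_normed_vector set"
  "{f. \<exists>K. cfunctional K f}" Gauss_rationals
proof
  show "countable Gauss_rationals" unfolding Gauss_rationals_def by (intro countable_image countable_SIGMA countable_rat)
next
  fix f :: "'a \<Rightarrow> complex" and v :: 'a assume "f \<in> {f. \<exists>K. cfunctional K f}"
  then obtain K where f: "cfunctional K f" by blast
  have "cfunctional (K / cmod (f v)) (\<lambda>x. f x / f v)"
    unfolding cfunctional_def
    using cfunctional_bound[OF f]
    by (auto simp: cfunctional_add[OF f] cfunctional_scaleC[OF f] add_divide_distrib norm_divide divide_right_mono)
  then show "(\<lambda>x. f x / f v) \<in> {f. \<exists>K. cfunctional K f}" by blast
next
  fix S :: "'a set" and v :: 'a and d :: real
  assume d: "0 \<le> d" "\<And>y. y \<in> qspan Gauss_rationals S \<Longrightarrow> d \<le> norm (v - y)"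
  have far: "d \<le> norm (v - y)" if y: "y \<in> complex_vector.span S" for y
  proof (rule field_le_epsilon)
    fix \<epsilon> :: real assume "0 < \<epsilon>"
    then obtain y0 where "y0 \<in> qspan Gauss_rationals S" "norm (y - y0) < \<epsilon>"
      using qspan_approximates_span[of "\<lambda>x. x" S "\<lambda>c. c" Gauss_rationals y \<epsilon>] Gauss_rationals_dense y by blast
    then show "d \<le> norm (v - y) + \<epsilon>"
      using d(2)[of y0] norm_triangle_ineq[of "v - y" "y - y0"] by simp
  qed
  have "\<exists>f. cfunctional 1 f \<and> (\<forall>y\<in>complex_vector.span S. f y = 0) \<and> f v = of_real d"
    by (rule distance_functional_subspace[OF complex_vector.subspace_span d(1)]) (rule far)
  then obtain f where f: "cfunctional 1 f" "\<forall>y\<in>complex_vector.span S. f y = 0" "f v = of_real d"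
    by (elim exE conjE) (rule that)
  have "\<forall>s\<in>S. f s = 0" using f(2) complex_vector.span_base[of _ S] by simp
  then show "\<exists>f\<in>{f. \<exists>K. cfunctional K f}. cfunctional 1 f \<and> (\<forall>s\<in>S. f s = 0) \<and> f v = complex_of_real d"
    using f(1,3) by (intro bexI[of _ f]) auto
next
  show "(\<lambda>_. 0 :: complex) \<in> {f :: 'a \<Rightarrow> complex. \<exists>K. cfunctional K f}"
    using cfunctional_zero[of 1] by (intro CollectI exI[of _ 1]) simp
qed auto

locale complex_conjugation =
  fixes C :: "'a::complex_normed_vector \<Rightarrow> 'a"
  assumes C_add: "C (x + y) = C x + C y" and C_scaleC: "C (c *\<^sub>C x) = cnj c *\<^sub>C C x"
    and C_C: "C (C x) = x" and norm_C: "norm (C x) = norm x"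
begin

definition fixed :: "'a set" where "fixed = {x. C x = x}"
definition real_functionals :: "('a \<Rightarrow> complex) set"
  where "real_functionals = {f. (\<exists>K. cfunctional K f) \<and> (\<forall>x. f (C x) = cnj (f x))}"

lemma C_scaleR: "C (r *\<^sub>R x) = r *\<^sub>R C x"
  using C_scaleC[of "of_real r" x] by (simp add: scaleC_of_real)

lemma linear_C: "linear C"
  by (intro linearI C_add C_scaleR)

sublocale dual_setting fixed real_functionals "of_real ` \<rat>"
proof
  show "countable (complex_of_real ` \<rat>)" by (intro countable_image countable_rat)
next
  fix f and v assume f: "f \<in> real_functionals" and v: "v \<in> fixed"
  obtain K where K: "cfunctional K f" using f by (auto simp: real_functionals_def)
  have "cfunctional (K / cmod (f v)) (\<lambda>x. f x / f v)"
    unfolding cfunctional_def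
    using cfunctional_bound[OF K]
    by (auto simp: cfunctional_add[OF K] cfunctional_scaleC[OF K] add_divide_distrib norm_divide divide_right_mono)
  moreover have "cnj (f v) = f v" using f v by (metis (mono_tags, lifting) fixed_def mem_Collect_eq real_functionals_def)
  ultimately show "(\<lambda>x. f x / f v) \<in> real_functionals"
    using f by (auto simp: real_functionals_def)
next
  fix v r assume "v \<in> fixed" then show "r *\<^sub>R v \<in> fixed" by (simp add: fixed_def C_scaleR)
next
  fix S assume S: "S \<subseteq> fixed"
  show "qspan (complex_of_real ` \<rat>) S \<subseteq> fixed"
  proof
    fix x assume "x \<in> qspan (complex_of_real ` \<rat>) S"
    then show "x \<in> fixed"
    proof induction
      case zero
      show ?case using linear_0[OF linear_C] by (simp add: fixed_def)
    next
      case (step y q s)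
      then show ?case using S by (auto simp: fixed_def C_add C_scaleC)
    qed
  qed
next
  fix S v and d :: real
  assume S: "S \<subseteq> fixed" and v: "v \<in> fixed" and d: "0 \<le> d"
    "\<And>y. y \<in> qspan (complex_of_real ` \<rat>) S \<Longrightarrow> d \<le> norm (v - y)"
  define \<rho> where "\<rho> y = (1 / 2) *\<^sub>R (y + C y)" for y
  have Cs: "C s = s" if "s \<in> S" for s using S that by (auto simp: fixed_def)
  have \<rho>0: "\<rho> 0 = 0" using linear_0[OF linear_C] by (simp add: \<rho>_def)
  have \<rho>: "\<rho> (c *\<^sub>C s + y) = of_real (Re c) *\<^sub>C s + \<rho> y" if "s \<in> S" for c s y
  proof -
    have "c *\<^sub>C s + cnj c *\<^sub>C s = (2 * Re c) *\<^sub>R s"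
      by (simp only: scaleC_add_left[symmetric] complex_add_cnj scaleC_of_real)
    then have eq: "c *\<^sub>C s + y + C (c *\<^sub>C s + y) = (2 * Re c) *\<^sub>R s + (y + C y)"
      using Cs[OF that] by (simp add: C_add C_scaleC add_ac)
    show ?thesis unfolding \<rho>_def eq by (simp add: scaleC_of_real scaleR_add_right)
  qed
  have dense: "\<exists>q\<in>complex_of_real ` \<rat>. cmod (of_real (Re c) - q) < \<epsilon>" if \<epsilon>: "0 < \<epsilon>" for c \<epsilon>
  proof -
    obtain r where "r \<in> \<rat>" "\<bar>Re c - r\<bar> < \<epsilon>" using rational_approximation[OF \<epsilon>] by blast
    then show ?thesis by (intro bexI[of _ "of_real r"]) (auto simp flip: of_real_diff)
  qed
  have far: "d \<le> norm (v - y)" if y: "y \<in> complex_vector.span S" for y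
  proof (rule field_le_epsilon)
    fix \<epsilon> :: real assume "0 < \<epsilon>"
    then obtain y0 where y0: "y0 \<in> qspan (complex_of_real ` \<rat>) S" "norm (\<rho> y - y0) < \<epsilon>"
      using qspan_approximates_span[OF \<rho>0 \<rho> dense y, of \<epsilon>] by blast
    have "v - \<rho> y = (1 / 2) *\<^sub>R ((v - y) + C (v - y))"
      using v by (simp add: \<rho>_def fixed_def linear_diff[OF linear_C] algebra_simps flip: scaleR_add_left)
    then have "norm (v - \<rho> y) \<le> norm (v - y)"
      using norm_triangle_ineq[of "v - y" "C (v - y)"] by (simp add: norm_C)
    then show "d \<le> norm (v - y) + \<epsilon>"
      using d(2)[OF y0(1)] y0(2) norm_triangle_ineq[of "v - \<rho> y" "\<rho> y - y0"] by simp
  qed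
  have "\<exists>f. cfunctional 1 f \<and> (\<forall>y\<in>complex_vector.span S. f y = 0) \<and> f v = of_real d"
    by (rule distance_functional_subspace[OF complex_vector.subspace_span d(1)]) (rule far)
  then obtain f where f: "cfunctional 1 f" "\<forall>y\<in>complex_vector.span S. f y = 0" "f v = of_real d"
    by (elim exE conjE) (rule that)
  have fS: "f s = 0" if "s \<in> S" for s using f(2) complex_vector.span_base[OF that] by simp
  define h where "h x = (f x + cnj (f (C x))) / 2" for x
  have "cmod (h x) \<le> 1 * norm x" for x
  proof -
    have "cmod (h x) \<le> (cmod (f x) + cmod (f (C x))) / 2"
      unfolding h_def using norm_triangle_ineq[of "f x" "cnj (f (C x))"] by (simp add: norm_divide)
    then show ?thesis
      using cfunctional_bound[OF f(1), of x] cfunctional_bound[OF f(1), of "C x"] by (simp add: norm_C)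
  qed
  then have "cfunctional 1 h"
    unfolding cfunctional_def
    by (auto simp: h_def C_add C_scaleC cfunctional_add[OF f(1)] cfunctional_scaleC[OF f(1)] field_simps)
  moreover have "h \<in> real_functionals"
    using calculation by (auto simp: real_functionals_def h_def C_C add.commute)
  moreover have "\<forall>s\<in>S. h s = 0" using fS Cs by (simp add: h_def)
  moreover have "h v = of_real d" using v by (simp add: h_def fixed_def f(3))
  ultimately show "\<exists>f\<in>real_functionals. cfunctional 1 f \<and> (\<forall>s\<in>S. f s = 0) \<and> f v = complex_of_real d" by blast
next
  show "(\<lambda>_. 0) \<in> real_functionals"
    using cfunctional_zero[of 1] by (auto simp: real_functionals_def intro: exI[of _ 1])
qed (auto simp: real_functionals_def)

text \<open>
  Both \<open>x + C x\<close> and \<open>\<i> (x - C x)\<close> are fixed by the conjugation, and \<open>x\<close> vanishes if they do.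
\<close>

lemma total_separates:
  assumes tot: "total \<Gamma>" and \<Gamma>: "\<Gamma> \<subseteq> real_functionals" and x: "\<And>f. f \<in> \<Gamma> \<Longrightarrow> f x = 0"
  shows "x = 0"
proof -
  have f0: "f (x + C x) = 0" "f (\<i> *\<^sub>C (x - C x)) = 0" if f: "f \<in> \<Gamma>" for f
  proof -
    obtain K where K: "cfunctional K f" using f \<Gamma> by (auto simp: real_functionals_def)
    have "f (C x) = 0" using f \<Gamma> x[OF f] by (auto simp: real_functionals_def)
    then show "f (x + C x) = 0" "f (\<i> *\<^sub>C (x - C x)) = 0"
      using x[OF f] by (simp_all add: cfunctional_add[OF K] cfunctional_scaleC[OF K] cfunctional_diff[OF K])
  qed
  have "x + C x \<in> fixed" by (simp add: fixed_def C_add C_C add.commute)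
  then have 1: "x + C x = 0" using tot f0(1) unfolding total_def by blast
  have "C (\<i> *\<^sub>C (x - C x)) = \<i> *\<^sub>C (x - C x)"
    by (simp add: C_scaleC linear_diff[OF linear_C] C_C complex_vector.scale_right_diff_distrib
        complex_vector.scale_minus_left)
  then have "\<i> *\<^sub>C (x - C x) \<in> fixed" by (simp add: fixed_def)
  then have "\<i> *\<^sub>C (x - C x) = 0" using tot f0(2) unfolding total_def by blast
  then have 2: "x - C x = 0" by simp
  have "2 *\<^sub>R x = (x + C x) + (x - C x)" by (simp add: scaleR_2)
  then show ?thesis using 1 2 by simp
qed

end

section \<open>Norms with few real isometries\<close>

lemma dim_ge_2_not_separated_by_one:
  assumes dim: "complex_dim_at_least 2 TYPE('b::complex_normed_vector)" and f: "cfunctional K (f :: 'b \<Rightarrow> complex)"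
  shows "\<exists>x. f x = 0 \<and> x \<noteq> 0"
proof -
  obtain B :: "'b set" where B: "complex_vector.independent B" "infinite B \<or> 2 \<le> card B"
    using dim unfolding complex_dim_at_least_def by blast
  obtain x where x: "x \<in> B" using B(2) by (metis all_not_in_conv card.empty finite.emptyI not_numeral_le_zero)
  have "\<exists>y. y \<in> B - {x}"
  proof (rule ccontr)
    assume "\<not> ?thesis"
    then have "B = {x}" using x by blast
    then show False using B(2) by simp
  qed
  then obtain y where y: "y \<in> B" "y \<noteq> x" by blast
  have x0: "x \<noteq> 0" using B(1) x complex_vector.dependent_zero by blast
  show ?thesis
  proof (cases "f x = 0")
    case True
    then show ?thesis using x0 by blast
  next
    case False
    let ?w = "y - (f y / f x) *\<^sub>C x"
    have "f ?w = 0" using False by (simp add: cfunctional_diff[OF f] cfunctional_scaleC[OF f])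
    moreover have "?w \<noteq> 0"
    proof
      assume "?w = 0"
      then have "(f y / f x) *\<^sub>C x = y" by simp
      moreover have "(f y / f x) *\<^sub>C x \<in> complex_vector.span (B - {y})"
        using x y by (intro complex_vector.span_scale complex_vector.span_base) auto
      ultimately have "y \<in> complex_vector.span (B - {y})" by metis
      then show False using B(1) y(1) complex_vector.dependent_def by blast
    qed
    ultimately show ?thesis by blast
  qed
qed

lemma cfunctional_scaleC_eqI:
  assumes "\<And>h. h \<in> \<Gamma> \<Longrightarrow> \<exists>K. cfunctional K h" and "\<And>x. (\<And>h. h \<in> \<Gamma> \<Longrightarrow> h x = 0) \<Longrightarrow> x = 0"
    and "\<And>h. h \<in> \<Gamma> \<Longrightarrow> h y = u * h z"
  shows "y = u *\<^sub>C z"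
proof -
  have "h (y - u *\<^sub>C z) = 0" if h: "h \<in> \<Gamma>" for h
  proof -
    obtain K where "cfunctional K h" using assms(1)[OF h] by blast
    then show ?thesis using assms(3)[OF h] by (simp add: cfunctional_diff cfunctional_scaleC)
  qed
  then show ?thesis using assms(2)[of "y - u *\<^sub>C z"] by simp
qed

text \<open>
  With \<open>\<zeta> = 3\<i>\<close> only the identity fixes \<open>\<zeta>\<close>, so all isometries act on the functionals by scalars.
\<close>

theorem exists_norm_trivial_isometries:
  assumes dim: "complex_dim_at_least 2 TYPE('b::complex_normed_vector)"
  shows "\<exists>N :: 'b \<Rightarrow> real. equivalent_complex_norm N \<and> (\<forall>T. real_isometry N T \<longrightarrow> trivial_isometry T)"
proof -
  have "\<not> (\<exists>f :: 'b \<Rightarrow> complex. f \<in> {f. \<exists>K. cfunctional K f} \<and> all_vectors.total {f})"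
    using dim_ge_2_not_separated_by_one[OF dim] unfolding all_vectors.total_def by blast
  moreover have "cmod (3 * \<i>) = 3" "Re (3 * \<i>) \<le> 0" by (simp_all add: norm_mult)
  ultimately obtain I :: "'b set" and f g lt a b K where
    sys: "rigid_system I (\<lambda>i. i) f g lt a b K (3 * \<i>)"
    and fg: "\<forall>i\<in>I. f i \<in> {f. \<exists>K. cfunctional K f} \<and> g i \<in> {f. \<exists>K. cfunctional K f}"
    and tot: "all_vectors.total (f ` I \<union> g ` I)"
    using all_vectors.exists_rigid_system_or_line[of "3 * \<i>"] by blast
  interpret rigid_system I "\<lambda>i. i" f g lt a b K "3 * \<i>" by (rule sys)
  have "trivial_isometry T" if T: "real_isometry N T" for T
  proof -
    obtain u c where u: "cmod u = 1" and c: "c = (\<lambda>z. z) \<or> c = cnj" "c (3 * \<i>) = 3 * \<i>"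
      and act: "\<forall>i\<in>I. \<forall>y. f i (T y) = u * c (f i y) \<and> g i (T y) = u * c (g i y)"
      using isometry_acts_by_phase[OF T] by blast
    have id: "c = (\<lambda>z. z)" using c by (auto simp: complex_eq_iff)
    have "T x = u *\<^sub>C x" for x
    proof (rule cfunctional_scaleC_eqI[where \<Gamma> = "f ` I \<union> g ` I"])
      show "\<exists>K. cfunctional K h" if "h \<in> f ` I \<union> g ` I" for h using fg that by blast
      show "x = 0" if "\<And>h. h \<in> f ` I \<union> g ` I \<Longrightarrow> h x = 0" for x
        using tot that unfolding all_vectors.total_def by blast
      show "h (T x) = u * h x" if "h \<in> f ` I \<union> g ` I" for h using act that id by auto
    qed
    then show ?thesis using u unfolding trivial_isometry_def by blast
  qed
  then show ?thesis using equivalent_complex_norm_N by blast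
qed

context complex_conjugation
begin

lemma real_isometry_unimodular:
  assumes N: "is_complex_norm N" and NC: "\<And>x. N (C x) = N x" and u: "cmod u = 1"
  shows "real_isometry N (\<lambda>x. u *\<^sub>C x)" "real_isometry N (\<lambda>x. u *\<^sub>C C x)"
proof -
  have u0: "u \<noteq> 0" using u by auto
  have sc: "u *\<^sub>C (r *\<^sub>R x) = r *\<^sub>R (u *\<^sub>C x)" for r and x :: 'a
    by (simp add: scaleC_scaleC mult.commute flip: scaleC_of_real)
  have inv: "u *\<^sub>C (inverse u *\<^sub>C x) = x" for x :: 'a using u0 by (simp add: scaleC_scaleC scaleC_one)
  have Nu: "N (u *\<^sub>C x - u *\<^sub>C y) = N (x - y)" for x y
    using N u by (simp add: is_complex_norm_def flip: complex_vector.scale_right_diff_distrib)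
  have "linear (\<lambda>x :: 'a. u *\<^sub>C x)" by (intro linearI) (simp_all add: scaleC_add_right sc)
  moreover have "surj (\<lambda>x :: 'a. u *\<^sub>C x)" using inv by (metis surjI)
  ultimately show "real_isometry N (\<lambda>x. u *\<^sub>C x)" using Nu by (simp add: real_isometry_def)
  have "linear (\<lambda>x. u *\<^sub>C C x)" by (intro linearI) (simp_all add: scaleC_add_right sc C_add C_scaleR)
  moreover have "surj (\<lambda>x. u *\<^sub>C C x)"
    by (rule surjI[of _ "\<lambda>x. C (inverse u *\<^sub>C x)"]) (simp only: C_C inv)
  moreover have "N (C x - C y) = N (x - y)" for x y
    using NC[of "x - y"] by (simp add: linear_diff[OF linear_C])
  ultimately show "real_isometry N (\<lambda>x. u *\<^sub>C C x)" using Nu by (simp add: real_isometry_def)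
qed

lemma unimodular_of_functionals:
  assumes tot: "total \<Gamma>" and \<Gamma>: "\<Gamma> \<subseteq> real_functionals" and u: "cmod u = 1"
    and c: "c = (\<lambda>z. z) \<or> c = cnj" and act: "\<And>h x. h \<in> \<Gamma> \<Longrightarrow> h (T x) = u * c (h x)"
  shows "T = (\<lambda>x. u *\<^sub>C x) \<or> T = (\<lambda>x. u *\<^sub>C C x)"
proof -
  have eqI: "y = u *\<^sub>C z" if "\<And>h. h \<in> \<Gamma> \<Longrightarrow> h y = u * h z" for y z
  proof (rule cfunctional_scaleC_eqI[where \<Gamma> = \<Gamma>])
    show "\<exists>K. cfunctional K h" if "h \<in> \<Gamma>" for h using \<Gamma> that by (auto simp: real_functionals_def)
    show "x = 0" if "\<And>h. h \<in> \<Gamma> \<Longrightarrow> h x = 0" for x using total_separates[OF tot \<Gamma> that] .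
  qed (rule that)
  from c show ?thesis
  proof
    assume "c = (\<lambda>z. z)"
    then have "T x = u *\<^sub>C x" for x using act by (intro eqI) simp
    then show ?thesis by blast
  next
    assume c: "c = cnj"
    have "T x = u *\<^sub>C C x" for x
    proof (rule eqI)
      fix h assume h: "h \<in> \<Gamma>"
      then have "h (C x) = cnj (h x)" using \<Gamma> by (auto simp: real_functionals_def)
      then show "h (T x) = u * h (C x)" using act[OF h] c by simp
    qed
    then show ?thesis by blast
  qed
qed

text \<open>
  On a space of dimension at most one the original norm already has the required isometries.
\<close>

lemma line_isometries:
  assumes f: "f \<in> real_functionals" and tot: "total {f}" and T: "real_isometry norm T"
  shows "\<exists>u. cmod u = 1 \<and> (T = (\<lambda>x. u *\<^sub>C x) \<or> T = (\<lambda>x. u *\<^sub>C C x))"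
proof -
  obtain K where K: "cfunctional K f" using f by (auto simp: real_functionals_def)
  have lin: "linear T" using T by (simp add: real_isometry_def)
  have "norm (T x - T 0) = norm (x - 0)" for x using T unfolding real_isometry_def by blast
  then have iso: "norm (T x) = norm x" for x by (simp add: linear_0[OF lin])
  have inj: "x = 0" if "f x = 0" for x
    using total_separates[OF tot, of x] f that by simp
  have "cmod (f (T x)) = cmod (f x)" for x
  proof (cases "x = 0")
    case True
    then show ?thesis by (simp add: linear_0[OF lin])
  next
    case False
    then have fx: "f x \<noteq> 0" using inj by blast
    have "f (T x - (f (T x) / f x) *\<^sub>C x) = 0"
      using fx by (simp add: cfunctional_diff[OF K] cfunctional_scaleC[OF K])
    then have "T x = (f (T x) / f x) *\<^sub>C x" using inj by fastforce
    then have "norm x = cmod (f (T x) / f x) * norm x" using iso[of x] by (metis norm_scaleC)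
    then show ?thesis using False fx by (simp add: norm_divide field_simps)
  qed
  moreover have "linear (\<lambda>x. f (T x))"
    using linear_compose[OF lin cfunctional_linear[OF K]] by (simp add: o_def)
  ultimately obtain u c where u: "cmod u = 1" and c: "c = (\<lambda>z. z) \<or> c = cnj"
    and act: "\<forall>x. f (T x) = u * c (f x)"
    using modulus_eq_imp_unimodular_multiple[OF _ K, of "\<lambda>x. f (T x)"] by blast
  have "T = (\<lambda>x. u *\<^sub>C x) \<or> T = (\<lambda>x. u *\<^sub>C C x)"
    by (rule unimodular_of_functionals[OF tot _ u c]) (use f act in auto)
  then show ?thesis using u by blast
qed

theorem exists_norm_conjugation_isometries:
  "\<exists>N :: 'a \<Rightarrow> real. equivalent_complex_norm N \<and>
    {T. real_isometry N T} = {T. trivial_isometry T} \<union> {T. \<exists>u. cmod u = 1 \<and> T = (\<lambda>x. u *\<^sub>C C x)}"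
proof -
  have key: "{T. real_isometry N T} = {T. trivial_isometry T} \<union> {T. \<exists>u. cmod u = 1 \<and> T = (\<lambda>x. u *\<^sub>C C x)}"
    if N: "is_complex_norm N" and NC: "\<And>x. N (C x) = N x"
      and all: "\<And>T. real_isometry N T \<Longrightarrow> \<exists>u. cmod u = 1 \<and> (T = (\<lambda>x. u *\<^sub>C x) \<or> T = (\<lambda>x. u *\<^sub>C C x))"
    for N
  proof (intro set_eqI iffI)
    fix T assume "T \<in> {T. real_isometry N T}"
    then show "T \<in> {T. trivial_isometry T} \<union> {T. \<exists>u. cmod u = 1 \<and> T = (\<lambda>x. u *\<^sub>C C x)}"
      using all[of T] unfolding trivial_isometry_def by blast
  next
    fix T assume "T \<in> {T. trivial_isometry T} \<union> {T. \<exists>u. cmod u = 1 \<and> T = (\<lambda>x. u *\<^sub>C C x)}"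
    then show "T \<in> {T. real_isometry N T}"
      using real_isometry_unimodular[OF N NC] unfolding trivial_isometry_def by blast
  qed
  have "cmod (- 3) = 3" "Re (- 3) \<le> 0" by simp_all
  then consider
    (rigid) I :: "'a set" and f g lt a b K where "rigid_system I (\<lambda>i. i) f g lt a b K (- 3)"
      "\<forall>i\<in>I. f i \<in> real_functionals \<and> g i \<in> real_functionals" "total (f ` I \<union> g ` I)"
    | (line) f where "f \<in> real_functionals" "total {f}"
    using exists_rigid_system_or_line[of "- 3"] by blast
  then show ?thesis
  proof cases
    case rigid
    interpret R: rigid_system I "\<lambda>i. i" f g lt a b K "- 3" by (rule rigid(1))
    have "R.N (C x) = R.N x" for x
      using rigid(2) by (intro R.N_conjugation_invariant norm_C) (auto simp: real_functionals_def)
    moreover have "\<exists>u. cmod u = 1 \<and> (T = (\<lambda>x. u *\<^sub>C x) \<or> T = (\<lambda>x. u *\<^sub>C C x))" if T: "real_isometry R.N T" for T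
    proof -
      obtain u c where u: "cmod u = 1" and c: "c = (\<lambda>z. z) \<or> c = cnj"
        and act: "\<forall>i\<in>I. \<forall>y. f i (T y) = u * c (f i y) \<and> g i (T y) = u * c (g i y)"
        using R.isometry_acts_by_phase[OF T] by blast
      have "T = (\<lambda>x. u *\<^sub>C x) \<or> T = (\<lambda>x. u *\<^sub>C C x)"
        by (rule unimodular_of_functionals[OF rigid(3) _ u c]) (use rigid(2) act in auto)
      then show ?thesis using u by blast
    qed
    ultimately have "{T. real_isometry R.N T} = {T. trivial_isometry T} \<union> {T. \<exists>u. cmod u = 1 \<and> T = (\<lambda>x. u *\<^sub>C C x)}"
      by (rule key[OF R.is_complex_norm_N])
    then show ?thesis using R.equivalent_complex_norm_N by blast
  next
    case line
    have norm: "is_complex_norm (norm :: 'a \<Rightarrow> real)"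
      by (simp add: is_complex_norm_def norm_triangle_ineq norm_scaleC)
    then have "equivalent_complex_norm (norm :: 'a \<Rightarrow> real)"
      unfolding equivalent_complex_norm_def by (auto intro!: exI[of _ 1])
    then show ?thesis using key[OF norm norm_C line_isometries[OF line]] by blast
  qed
qed

end

lemma complex_conjugation_of_canonical:
  fixes J :: "'z::banach \<times> 'z \<Rightarrow> 'a::complex_banach"
  assumes J: "canonical_complex_structure J"
  shows "complex_conjugation (conjugation J)"
proof -
  let ?C = "conjugation J"
  have bij: "bij J" and lin: "linear J" and iJ: "\<i> *\<^sub>C J (y, z) = J (- z, y)" and iso: "real_isometry norm ?C" for y z
    using J by (auto simp: canonical_complex_structure_def bounded_linear.linear)
  have CJ: "?C (J (y, z)) = J (y, - z)" for y z
    using bij by (simp add: conjugation_def bij_is_inj)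
  have surj: "\<exists>y z. x = J (y, z)" for x using bij by (metis bij_pointE surj_pair)
  have Clin: "linear ?C" using iso by (simp add: real_isometry_def)
  have Ci: "?C (\<i> *\<^sub>C x) = - (\<i> *\<^sub>C ?C x)" for x
  proof -
    obtain y z where x: "x = J (y, z)" using surj by blast
    have "- J (z, y) = J (- (z, y))" by (rule linear_neg[OF lin, symmetric])
    then show ?thesis by (simp add: x iJ CJ)
  qed
  have split: "c *\<^sub>C x = Re c *\<^sub>R x + Im c *\<^sub>R (\<i> *\<^sub>C x)" for c and x :: 'a
    by (metis (no_types) complex_eq mult.commute scaleC_add_left scaleC_of_real scaleC_scaleC)
  show ?thesis
  proof
    fix x y :: 'a and c :: complex
    show "?C (x + y) = ?C x + ?C y" by (rule linear_add[OF Clin])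
    show "?C (c *\<^sub>C x) = cnj c *\<^sub>C ?C x"
      unfolding split[of c] split[of "cnj c"]
      by (simp add: linear_add[OF Clin] linear_scale[OF Clin] Ci)
    show "?C (?C x) = x" using surj[of x] by (auto simp: CJ)
    have "norm (?C x - ?C 0) = norm (x - 0)" using iso unfolding real_isometry_def by blast
    then show "norm (?C x) = norm x" by (simp add: linear_0[OF Clin])
  qed
qed

theorem corollary31:
  fixes J :: "'z::banach \<times> 'z \<Rightarrow> 'a::complex_banach"
  shows "(complex_dim_at_least 2 TYPE('b::complex_banach) \<longrightarrow>
            (\<exists>N :: 'b \<Rightarrow> real. equivalent_complex_norm N \<and>
              (\<forall>T. real_isometry N T \<longrightarrow> trivial_isometry T))) \<and>
         (canonical_complex_structure J \<longrightarrow>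
            (\<exists>N :: 'a \<Rightarrow> real. equivalent_complex_norm N \<and>
              {T. real_isometry N T} = {T. trivial_isometry T} \<union> {T. conjugation_isometry J T}))"
proof (intro conjI impI)
  assume "complex_dim_at_least 2 TYPE('b)"
  then show "\<exists>N :: 'b \<Rightarrow> real. equivalent_complex_norm N \<and> (\<forall>T. real_isometry N T \<longrightarrow> trivial_isometry T)"
    by (rule exists_norm_trivial_isometries)
next
  assume "canonical_complex_structure J"
  then interpret complex_conjugation "conjugation J" by (rule complex_conjugation_of_canonical)
  show "\<exists>N :: 'a \<Rightarrow> real. equivalent_complex_norm N \<and>
      {T. real_isometry N T} = {T. trivial_isometry T} \<union> {T. conjugation_isometry J T}"
    using exists_norm_conjugation_isometries unfolding conjugation_isometry_def .
qed

end
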